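(* Let $G$ and $V$ be finite groups, $V$ abelian (written additively), with $G$ acting on $V$ from the right by automorphisms, and let $f:G\to V$ be a surjective 1-cocycle. Let $H\leq G$ be the kernel of $f$. Then $\mathbb CV\cong\mathbb C^V\cong\mathrm{Ind}_H^G\mathbb C$ as $\mathbb CG$-modules, where $\mathbb C=\mathbb C_H$ is the trivial $H$-module.
   Context: The action of $g\in G$ on $v\in V$ is denoted $v\mapsto vg$. A (right) 1-cocycle is a map $f:G\to V$ with $f(xg)=f(x)g+f(g)$ for all $x,g\in G$; its kernel $\{g\in G: f(g)=0\}$ is a subgroup of $G$. The group algebra $\mathbb CV$ is identified with the space $\mathbb C^V$ of functions $V\to\mathbb C$ via $\tau\mapsto\sum_{v\in V}\tau(v)v$. The set $\hat V=\mathrm{Hom}((V,+),\mathbb C^* )$ of linear characters is a $\mathbb C$-basis of $\mathbb C^V$. For $\tau\in\mathbb C^V$, $g\in G$ let $\tau.g\in\mathbb C^V$ be given by $(\tau.g)(v)=\tau(vg^{-1})$; this permutes $\hat V$. The right $\mathbb CG$-module structure on $\mathbb CV\cong\mathbb C^V$ in the claim is the monomial one attached to $f$, defined on the basis $\hat V$ by $\chi g=\chi(f(g^{-1}))\,\chi.g$ for $\chi\in\hat V$, $g\in G$, and extended linearly. *)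

theory Defs
  imports Complex_Main "HOL-Algebra.Ring" "HOL-Algebra.Free_Abelian_Groups" "HOL-Algebra.Generated_Groups"
begin

section \<open>Right modules over a not necessarily commutative ring\<close>

text \<open>The modules of HOL-Algebra are left modules over commutative rings. As there, the record of
  a module extends that of a ring, of which only the additive part is used.\<close>

record ('r, 'm) rmodule = "'m ring" +
  rsmult :: "['m, 'r] \<Rightarrow> 'm" (infixl \<open>\<triangleleft>\<index>\<close> 70)

locale right_module = R?: ring R + M?: abelian_group M
  for R (structure) and M :: "('r, 'm, 'x) rmodule_scheme" (structure) +
  assumes rsmult_closed:
      "\<lbrakk>m \<in> carrier M; r \<in> carrier R\<rbrakk> \<Longrightarrow> m \<triangleleft>\<^bsub>M\<^esub> r \<in> carrier M"
    and rsmult_l_distr: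
      "\<lbrakk>m \<in> carrier M; n \<in> carrier M; r \<in> carrier R\<rbrakk> \<Longrightarrow>
        (m \<oplus>\<^bsub>M\<^esub> n) \<triangleleft>\<^bsub>M\<^esub> r = m \<triangleleft>\<^bsub>M\<^esub> r \<oplus>\<^bsub>M\<^esub> n \<triangleleft>\<^bsub>M\<^esub> r"
    and rsmult_r_distr:
      "\<lbrakk>m \<in> carrier M; r \<in> carrier R; s \<in> carrier R\<rbrakk> \<Longrightarrow>
        m \<triangleleft>\<^bsub>M\<^esub> (r \<oplus>\<^bsub>R\<^esub> s) = m \<triangleleft>\<^bsub>M\<^esub> r \<oplus>\<^bsub>M\<^esub> m \<triangleleft>\<^bsub>M\<^esub> s"
    and rsmult_assoc:
      "\<lbrakk>m \<in> carrier M; r \<in> carrier R; s \<in> carrier R\<rbrakk> \<Longrightarrow>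
        m \<triangleleft>\<^bsub>M\<^esub> (r \<otimes>\<^bsub>R\<^esub> s) = (m \<triangleleft>\<^bsub>M\<^esub> r) \<triangleleft>\<^bsub>M\<^esub> s"
    and rsmult_one:
      "m \<in> carrier M \<Longrightarrow> m \<triangleleft>\<^bsub>M\<^esub> \<one>\<^bsub>R\<^esub> = m"

definition rmodule_iso ::
    "('r, 'k) ring_scheme \<Rightarrow> ('r, 'm, 'x) rmodule_scheme \<Rightarrow> ('r, 'n, 'y) rmodule_scheme \<Rightarrow> ('m \<Rightarrow> 'n) set"
  where "rmodule_iso R M N =
    {\<phi> \<in> iso (add_monoid M) (add_monoid N).
       \<forall>m \<in> carrier M. \<forall>r \<in> carrier R. \<phi> (m \<triangleleft>\<^bsub>M\<^esub> r) = \<phi> m \<triangleleft>\<^bsub>N\<^esub> r}"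

definition is_rmodule_iso ::
    "('r, 'k) ring_scheme \<Rightarrow> ('r, 'm, 'x) rmodule_scheme \<Rightarrow> ('r, 'n, 'y) rmodule_scheme \<Rightarrow> bool"
  where "is_rmodule_iso R M N \<longleftrightarrow>
    right_module R M \<and> right_module R N \<and> rmodule_iso R M N \<noteq> {}"


section \<open>Extension of scalars\<close>

text \<open>For a ring \<open>A\<close> containing \<open>R\<close> as a subring (with the same operations), the right \<open>A\<close>-module
  \<open>M \<otimes>\<^sub>R A\<close>: the free abelian group on \<open>M \<times> A\<close> modulo the subgroup generated by the
  bilinearity and balancing relations, where \<open>b\<close> acts by \<open>m \<otimes> a \<mapsto> m \<otimes> ab\<close>.\<close>

definition tensor_relations ::
    "('a, 'k) ring_scheme \<Rightarrow> ('a, 'l) ring_scheme \<Rightarrow> ('a, 'm, 'x) rmodule_scheme \<Rightarrow> ('m \<times> 'a \<Rightarrow>\<^sub>0 int) set"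
  where "tensor_relations R A M =
    {frag_of (m \<oplus>\<^bsub>M\<^esub> n, a) - frag_of (m, a) - frag_of (n, a) | m n a.
        m \<in> carrier M \<and> n \<in> carrier M \<and> a \<in> carrier A} \<union>
    {frag_of (m, a \<oplus>\<^bsub>A\<^esub> b) - frag_of (m, a) - frag_of (m, b) | m a b.
        m \<in> carrier M \<and> a \<in> carrier A \<and> b \<in> carrier A} \<union>
    {frag_of (m \<triangleleft>\<^bsub>M\<^esub> r, a) - frag_of (m, r \<otimes>\<^bsub>A\<^esub> a) | m r a.
        m \<in> carrier M \<and> r \<in> carrier R \<and> a \<in> carrier A}"

definition extension_of_scalars ::
    "('a, 'k) ring_scheme \<Rightarrow> ('a, 'l) ring_scheme \<Rightarrow> ('a, 'm, 'x) rmodule_scheme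
      \<Rightarrow> ('a, ('m \<times> 'a \<Rightarrow>\<^sub>0 int) set) rmodule"
  where "extension_of_scalars R A M =
    (let F = free_Abelian_group (carrier M \<times> carrier A);
         K = generate F (tensor_relations R A M)
     in \<lparr>carrier = carrier (F Mod K), mult = undefined, one = undefined,
         ring.zero = one (F Mod K), add = mult (F Mod K),
         rsmult = (\<lambda>X b. K <#>\<^bsub>F\<^esub> (frag_extend (\<lambda>(m, a). frag_of (m, a \<otimes>\<^bsub>A\<^esub> b)) ` X))\<rparr>)"


section \<open>Group algebras and induced modules\<close>

definition group_algebra :: "('g, 'k) monoid_scheme \<Rightarrow> ('g \<Rightarrow>\<^sub>0 complex) ring"
  where "group_algebra G =
    \<lparr>carrier = {a. Poly_Mapping.keys a \<subseteq> carrier G},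
     mult = (\<lambda>a b. \<Sum>x\<in>Poly_Mapping.keys a. \<Sum>y\<in>Poly_Mapping.keys b.
        Poly_Mapping.single (x \<otimes>\<^bsub>G\<^esub> y) (Poly_Mapping.lookup a x * Poly_Mapping.lookup b y)),
     one = Poly_Mapping.single \<one>\<^bsub>G\<^esub> 1, ring.zero = 0, add = (+)\<rparr>"

definition trivial_rmodule :: "('g \<Rightarrow>\<^sub>0 complex, complex) rmodule"
  where "trivial_rmodule =
    \<lparr>carrier = UNIV, mult = (*), one = 1, ring.zero = 0, add = (+),
     rsmult = (\<lambda>c a. c * (\<Sum>x\<in>Poly_Mapping.keys a. Poly_Mapping.lookup a x))\<rparr>"

definition induced_rmodule ::
    "('g, 'k) monoid_scheme \<Rightarrow> 'g set \<Rightarrow> ('g \<Rightarrow>\<^sub>0 complex, 'm, 'x) rmodule_scheme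
      \<Rightarrow> ('g \<Rightarrow>\<^sub>0 complex, ('m \<times> ('g \<Rightarrow>\<^sub>0 complex) \<Rightarrow>\<^sub>0 int) set) rmodule"
  where "induced_rmodule G H W =
    extension_of_scalars (group_algebra (G\<lparr>carrier := H\<rparr>)) (group_algebra G) W"


section \<open>Right actions by automorphisms and cocycles\<close>

text \<open>Only the additive group of \<open>V\<close> is used; its multiplication is arbitrary.\<close>

locale right_action_by_automorphisms = G?: group G + V?: abelian_group V
  for G (structure) and V (structure) and act :: "'v \<Rightarrow> 'g \<Rightarrow> 'v" +
  assumes act_automorphism:
      "g \<in> carrier G \<Longrightarrow> (\<lambda>v. act v g) \<in> iso (add_monoid V) (add_monoid V)"
    and act_one: "v \<in> carrier V \<Longrightarrow> act v \<one>\<^bsub>G\<^esub> = v"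
    and act_mult:
      "\<lbrakk>v \<in> carrier V; x \<in> carrier G; y \<in> carrier G\<rbrakk> \<Longrightarrow> act v (x \<otimes>\<^bsub>G\<^esub> y) = act (act v x) y"

definition one_cocycle ::
    "('g, 'k) monoid_scheme \<Rightarrow> ('v, 'l) ring_scheme \<Rightarrow> ('v \<Rightarrow> 'g \<Rightarrow> 'v) \<Rightarrow> ('g \<Rightarrow> 'v) \<Rightarrow> bool"
  where "one_cocycle G V act f \<longleftrightarrow>
    f \<in> carrier G \<rightarrow> carrier V \<and>
    (\<forall>x \<in> carrier G. \<forall>g \<in> carrier G. f (x \<otimes>\<^bsub>G\<^esub> g) = act (f x) g \<oplus>\<^bsub>V\<^esub> f g)"

definition cocycle_kernel :: "('g, 'k) monoid_scheme \<Rightarrow> ('v, 'l) ring_scheme \<Rightarrow> ('g \<Rightarrow> 'v) \<Rightarrow> 'g set"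
  where "cocycle_kernel G V f = {g \<in> carrier G. f g = \<zero>\<^bsub>V\<^esub>}"


section \<open>The monomial module attached to a cocycle\<close>

definition complex_units :: "complex monoid"
  where "complex_units = \<lparr>carrier = UNIV - {0}, mult = (*), one = 1\<rparr>"

text \<open>Functions on \<open>V\<close> are taken to be extensional, i.e. \<^const>\<open>undefined\<close> outside the carrier.\<close>

definition linear_characters :: "('v, 'l) ring_scheme \<Rightarrow> ('v \<Rightarrow> complex) set"
  where "linear_characters V = hom (add_monoid V) complex_units \<inter> extensional (carrier V)"

definition translate ::
    "('g, 'k) monoid_scheme \<Rightarrow> ('v, 'l) ring_scheme \<Rightarrow> ('v \<Rightarrow> 'g \<Rightarrow> 'v)
      \<Rightarrow> ('v \<Rightarrow> complex) \<Rightarrow> 'g \<Rightarrow> 'v \<Rightarrow> complex"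
  where "translate G V act \<tau> g = (\<lambda>v\<in>carrier V. \<tau> (act v (inv\<^bsub>G\<^esub> g)))"

text \<open>Coordinates with respect to the basis of linear characters; they are uniquely determined on
  \<^term>\<open>linear_characters V\<close> when \<open>V\<close> is finite.\<close>

definition character_coordinates :: "('v, 'l) ring_scheme \<Rightarrow> ('v \<Rightarrow> complex) \<Rightarrow> ('v \<Rightarrow> complex) \<Rightarrow> complex"
  where "character_coordinates V \<tau> =
    (SOME c. \<tau> = (\<lambda>v\<in>carrier V. \<Sum>\<chi>\<in>linear_characters V. c \<chi> * \<chi> v))"

text \<open>The linear extension of \<open>\<chi> g = \<chi> (f (g\<inverse>)) (\<chi>.g)\<close>.\<close>

definition monomial_action ::
    "('g, 'k) monoid_scheme \<Rightarrow> ('v, 'l) ring_scheme \<Rightarrow> ('v \<Rightarrow> 'g \<Rightarrow> 'v) \<Rightarrow> ('g \<Rightarrow> 'v)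
      \<Rightarrow> ('v \<Rightarrow> complex) \<Rightarrow> 'g \<Rightarrow> 'v \<Rightarrow> complex"
  where "monomial_action G V act f \<tau> g =
    (\<lambda>v\<in>carrier V. \<Sum>\<chi>\<in>linear_characters V.
       character_coordinates V \<tau> \<chi> * (\<chi> (f (inv\<^bsub>G\<^esub> g)) * translate G V act \<chi> g v))"

definition function_rmodule ::
    "('g, 'k) monoid_scheme \<Rightarrow> ('v, 'l) ring_scheme \<Rightarrow> ('v \<Rightarrow> 'g \<Rightarrow> 'v) \<Rightarrow> ('g \<Rightarrow> 'v)
      \<Rightarrow> ('g \<Rightarrow>\<^sub>0 complex, 'v \<Rightarrow> complex) rmodule"
  where "function_rmodule G V act f =
    \<lparr>carrier = carrier V \<rightarrow>\<^sub>E UNIV,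
     mult = (\<lambda>\<sigma> \<tau>. \<lambda>v\<in>carrier V. \<sigma> v * \<tau> v), one = (\<lambda>v\<in>carrier V. 1),
     ring.zero = (\<lambda>v\<in>carrier V. 0), add = (\<lambda>\<sigma> \<tau>. \<lambda>v\<in>carrier V. \<sigma> v + \<tau> v),
     rsmult = (\<lambda>\<tau> a. \<lambda>v\<in>carrier V.
        \<Sum>g\<in>Poly_Mapping.keys a. Poly_Mapping.lookup a g * monomial_action G V act f \<tau> g v)\<rparr>"

definition function_to_algebra :: "('v, 'l) ring_scheme \<Rightarrow> ('v \<Rightarrow> complex) \<Rightarrow> 'v \<Rightarrow>\<^sub>0 complex"
  where "function_to_algebra V \<tau> = (\<Sum>v\<in>carrier V. Poly_Mapping.single v (\<tau> v))"

text \<open>The group algebra of \<open>(V, +)\<close>, with the monomial module structure carried over along the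
  identification \<^const>\<open>function_to_algebra\<close>.\<close>

definition algebra_rmodule ::
    "('g, 'k) monoid_scheme \<Rightarrow> ('v, 'l) ring_scheme \<Rightarrow> ('v \<Rightarrow> 'g \<Rightarrow> 'v) \<Rightarrow> ('g \<Rightarrow> 'v)
      \<Rightarrow> ('g \<Rightarrow>\<^sub>0 complex, 'v \<Rightarrow>\<^sub>0 complex) rmodule"
  where "algebra_rmodule G V act f =
    (let A = group_algebra (add_monoid V)
     in \<lparr>carrier = carrier A, mult = mult A, one = one A, ring.zero = ring.zero A, add = add A,
         rsmult = (\<lambda>x a. function_to_algebra V
           (inv_into (carrier V \<rightarrow>\<^sub>E UNIV) (function_to_algebra V) x
              \<triangleleft>\<^bsub>function_rmodule G V act f\<^esub> a))\<rparr>)"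

end

theory Submission
  imports Defs "HOL-Algebra.Multiplicative_Group"
begin

text \<open>
  The twisted formula \<open>\<chi> g = \<chi>(f(g\<inverse>)) \<chi>.g\<close> reads \<open>(\<chi> g)(v) = \<chi>(v g\<inverse> + f(g\<inverse>))\<close>. As the linear
  characters span \<open>\<complex>\<^sup>V\<close>, every function \<open>\<tau>\<close> satisfies \<open>(\<tau> g)(v) = \<tau>(v \<cdot> g\<inverse>)\<close>, where
  \<open>v \<cdot> g = vg + f(g)\<close> is an affine action of \<open>G\<close> on \<open>V\<close>. Hence \<open>\<complex>\<^sup>V\<close> is a permutation module; since
  \<open>0 \<cdot> g = f(g)\<close>, surjectivity of \<open>f\<close> makes the action transitive, and the stabilizer of \<open>0\<close> is \<open>H\<close>.
  So \<open>c \<otimes> a \<mapsto> (c \<delta>\<^sub>0) a\<close> identifies the induced module with \<open>\<complex>\<^sup>V\<close>.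
\<close>

section \<open>Linear characters span the functions on a finite abelian group\<close>

text \<open>The coordinates in \<open>monomial_action\<close> are a choice, about which nothing is
  known until some expansion exists, so the spanning statement carries the whole first half. It is a
  simultaneous diagonalisation: translations commute and have finite order, averaging against roots
  of unity splits any function into eigenfunctions, and a joint eigenfunction is a multiple of a
  character. On the other side, the tensor product is a literal quotient of the free abelian group
  on all pairs (c, a). Its coefficients are integers; complex scalars sit inside the generators and
  move only through the relations. The hard half is that the kernel of the comparison map is no
  larger than the relation subgroup. This is settled by a normal form: modulo the relations every
  element is a sum of terms \<tau>(v) \<otimes> s(v), where s picks one group element in each fibre
  of f, and these fibres are the cosets Hg.\<close>

lemma root_of_unity_power_neq_1:
  assumes "0 < i" "i < n"
  shows "cis (2 * pi / real n) ^ i \<noteq> 1"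
proof
  assume "cis (2 * pi / real n) ^ i = 1"
  then have "cos (2 * pi * real i / real n) = 1"
    by (simp add: DeMoivre complex_eq_iff mult.commute mult.left_commute)
  then obtain k :: int where "2 * pi * real i / real n = of_int k * 2 * pi"
    unfolding cos_one_2pi_int by auto
  with assms have "real i = of_int k * real n"
    by (simp add: field_simps)
  then have "real_of_int (int i) = real_of_int (k * int n)"
    by simp
  then have *: "int i = k * int n"
    by (simp only: of_int_eq_iff)
  then have "int n dvd int i" by simp
  with assms show False by (auto dest: dvd_imp_le)
qed

text \<open>For i > 0 the ratio of this geometric sum differs from 1 but has n-th power 1, so the
  sum vanishes. This is the orthogonality that lets the components of a function add up to
  it.\<close>

lemma sum_powers_root_of_unity:
  assumes "i < n"
  shows "(\<Sum>k<n. (cis (2 * pi / real n) ^ i) ^ k) = (if i = 0 then of_nat n else 0)"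
proof (cases "i = 0")
  case False
  have "(cis (2 * pi / real n) ^ i) ^ n = (cis (2 * pi / real n) ^ n) ^ i"
    by (simp add: power_mult[symmetric] mult.commute)
  also have "cis (2 * pi / real n) ^ n = 1"
    using assms by (simp add: DeMoivre)
  finally show ?thesis
    using False root_of_unity_power_neq_1[of i n] assms by (simp add: geometric_sum)
qed simp

text \<open>The zero function counts as an eigenfunction, so components that vanish need no separate
  case.\<close>

definition translation_eigenfunction ::
    "('v, 'l) ring_scheme \<Rightarrow> ('v \<Rightarrow> complex) \<Rightarrow> 'v \<Rightarrow> bool"
  where "translation_eigenfunction V \<tau> x \<longleftrightarrow>
    (\<exists>c. \<forall>v\<in>carrier V. \<tau> (v \<oplus>\<^bsub>V\<^esub> x) = c * \<tau> v)"

text \<open>Only values on the carrier are compared, because the averaged components met below are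
  not extensional.\<close>

definition character_span :: "('v, 'l) ring_scheme \<Rightarrow> ('v \<Rightarrow> complex) set"
  where "character_span V =
    {\<tau>. \<exists>c. \<forall>v\<in>carrier V. \<tau> v = (\<Sum>\<chi>\<in>linear_characters V. c \<chi> * \<chi> v)}"

lemma character_span_sum:
  assumes "\<And>k. k \<in> I \<Longrightarrow> T k \<in> character_span V"
    and "\<And>v. v \<in> carrier V \<Longrightarrow> \<tau> v = (\<Sum>k\<in>I. T k v)"
  shows "\<tau> \<in> character_span V"
proof -
  obtain c where c: "\<And>k v. k \<in> I \<Longrightarrow> v \<in> carrier V \<Longrightarrow>
      T k v = (\<Sum>\<chi>\<in>linear_characters V. c k \<chi> * \<chi> v)"
    using bchoice[of I "\<lambda>k c. \<forall>v\<in>carrier V. T k v = (\<Sum>\<chi>\<in>linear_characters V. c \<chi> * \<chi> v)"] assms(1)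
    by (auto simp: character_span_def)
  have "\<tau> v = (\<Sum>\<chi>\<in>linear_characters V. (\<Sum>k\<in>I. c k \<chi>) * \<chi> v)" if "v \<in> carrier V" for v
  proof -
    have "\<tau> v = (\<Sum>k\<in>I. \<Sum>\<chi>\<in>linear_characters V. c k \<chi> * \<chi> v)"
      using that assms(2) c by simp
    also have "\<dots> = (\<Sum>\<chi>\<in>linear_characters V. \<Sum>k\<in>I. c k \<chi> * \<chi> v)"
      by (rule sum.swap)
    finally show ?thesis by (simp add: sum_distrib_right)
  qed
  then show ?thesis
    unfolding character_span_def by (intro CollectI exI ballI)
qed

context abelian_group
begin

lemma linear_character_mult:
  "\<chi> \<in> linear_characters G \<Longrightarrow> x \<in> carrier G \<Longrightarrow> y \<in> carrier G \<Longrightarrow> \<chi> (x \<oplus> y) = \<chi> x * \<chi> y"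
  by (auto simp: linear_characters_def hom_def complex_units_def)

lemma linear_character_nonzero:
  "\<chi> \<in> linear_characters G \<Longrightarrow> x \<in> carrier G \<Longrightarrow> \<chi> x \<noteq> 0"
  by (auto simp: linear_characters_def hom_def complex_units_def)

lemma linear_character_zero:
  assumes "\<chi> \<in> linear_characters G"
  shows "\<chi> \<zero> = 1"
  using linear_character_mult[OF assms zero_closed zero_closed]
    linear_character_nonzero[OF assms zero_closed] by simp

lemma linear_character_add_pow:
  assumes "\<chi> \<in> linear_characters G" "x \<in> carrier G"
  shows "\<chi> ([(n::nat)] \<cdot> x) = \<chi> x ^ n"
  by (induction n) (use assms in \<open>simp_all add: linear_character_zero linear_character_mult\<close>)

lemma add_pow_card:
  "finite (carrier G) \<Longrightarrow> x \<in> carrier G \<Longrightarrow> [(card (carrier G))] \<cdot> x = \<zero>"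
  using group.pow_order_eq_1[OF a_group, of x] by (simp add: order_def add_pow_def)

text \<open>Since |V| x = 0, every value of a character is a |V|-th root of unity, which leaves
  finitely many extensional functions. Finiteness matters because a sum over an infinite set is 0 by
  convention.\<close>

lemma finite_linear_characters:
  assumes "finite (carrier G)"
  shows "finite (linear_characters G)"
proof (rule finite_subset)
  let ?n = "card (carrier G)"
  have "?n > 0"
    using assms zero_closed card_gt_0_iff by blast
  then show "finite (carrier G \<rightarrow>\<^sub>E {z::complex. z ^ ?n = 1})"
    using assms by (intro finite_PiE finite_roots_unity) auto
  show "linear_characters G \<subseteq> carrier G \<rightarrow>\<^sub>E {z. z ^ ?n = 1}"
  proof
    fix \<chi> assume \<chi>: "\<chi> \<in> linear_characters G"
    then have "\<chi> x ^ ?n = 1" if "x \<in> carrier G" for x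
      using that assms linear_character_add_pow[OF \<chi> that, of ?n]
      by (simp add: add_pow_card linear_character_zero)
    with \<chi> show "\<chi> \<in> carrier G \<rightarrow>\<^sub>E {z. z ^ ?n = 1}"
      by (auto simp: linear_characters_def PiE_iff)
  qed
qed

text \<open>With \<open>n = |V|\<close> and \<open>\<omega>\<close> a primitive \<open>n\<close>-th root of unity, the components are the averages
  \<open>T\<^sub>k(v) = n\<inverse> \<Sum>\<^sub>i \<omega>\<^sup>i\<^sup>k \<tau>(v + ix)\<close>, on which translation by \<open>x\<close> acts as \<open>\<omega>\<close> to the power \<open>-k\<close>.\<close>

lemma eigenfunction_decomposition:
  assumes fin: "finite (carrier G)" and x: "x \<in> carrier G"
  obtains T :: "nat \<Rightarrow> 'a \<Rightarrow> complex"
  where "\<And>v. v \<in> carrier G \<Longrightarrow> \<tau> v = (\<Sum>k<card (carrier G). T k v)"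
    and "\<And>k. translation_eigenfunction G (T k) x"
    and "\<And>k y. y \<in> carrier G \<Longrightarrow> translation_eigenfunction G \<tau> y \<Longrightarrow>
           translation_eigenfunction G (T k) y"
proof
  \<comment> \<open>The order of the group stands in for the order of x: all that is used is n > 0,
    n x = 0 and a primitive n-th root of unity.\<close>
  define n where "n = card (carrier G)"
  define \<omega> where "\<omega> = cis (2 * pi / real n)"
  define T where "T k v = (\<Sum>i<n. (\<omega> ^ i) ^ k * \<tau> (v \<oplus> [i] \<cdot> x)) / of_nat n" for k v
  have n: "n > 0"
    unfolding n_def using fin zero_closed card_gt_0_iff by blast
  have [simp]: "\<omega> ^ n = 1"
    using n by (simp add: \<omega>_def DeMoivre)
  have [simp]: "[n] \<cdot> x = \<zero>"
    unfolding n_def using fin x by (rule add_pow_card)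
  show "\<tau> v = (\<Sum>k<card (carrier G). T k v)" if "v \<in> carrier G" for v
  proof -
    have "(\<Sum>k<n. T k v) = (\<Sum>i<n. (\<Sum>k<n. (\<omega> ^ i) ^ k) * \<tau> (v \<oplus> [i] \<cdot> x)) / of_nat n"
      unfolding T_def
      by (subst sum_divide_distrib[symmetric], subst sum.swap) (simp add: sum_distrib_right)
    also have "\<dots> = (\<Sum>i<n. if i = 0 then of_nat n * \<tau> v else 0) / of_nat n"
      unfolding \<omega>_def using that x
      by (intro arg_cong2[of _ _ _ _ "(/)"] sum.cong) (auto simp: sum_powers_root_of_unity)
    also have "\<dots> = \<tau> v"
      using n by (simp add: sum.delta)
    finally show ?thesis by (simp add: n_def)
  qed
  show "translation_eigenfunction G (T k) x" for k
    unfolding translation_eigenfunction_def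
  proof (intro exI ballI)
    fix v assume v: "v \<in> carrier G"
    have \<omega>k: "(\<omega> ^ n) ^ k = 1"
      by simp
    let ?g = "\<lambda>i. (\<omega> ^ i) ^ k * \<tau> (v \<oplus> [i] \<cdot> x)"
    have "\<omega> ^ k * (\<Sum>i<n. (\<omega> ^ i) ^ k * \<tau> (v \<oplus> x \<oplus> [i] \<cdot> x)) = (\<Sum>i<n. ?g (Suc i))"
      using v x by (simp add: sum_distrib_left power_mult_distrib a_ac mult_ac)
    \<comment> \<open>Shifting i by one turns the term i = 0 into the term i = n; the two agree
      because \<open>\<omega> ^ n = 1\<close> and n x = 0.\<close>
    also have "\<dots> = (\<Sum>i<Suc n. ?g i) - ?g 0"
      by (subst sum.lessThan_Suc_shift) simp
    also have "\<dots> = (\<Sum>i<n. ?g i)"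
      using v x \<omega>k by simp
    finally have "\<omega> ^ k * T k (v \<oplus> x) = T k v"
      unfolding T_def by (simp add: field_simps)
    moreover have "\<omega> \<noteq> 0" by (simp add: \<omega>_def)
    ultimately show "T k (v \<oplus> x) = inverse (\<omega> ^ k) * T k v"
      by (simp add: field_simps)
  qed
  show "translation_eigenfunction G (T k) y"
    if y: "y \<in> carrier G" and "translation_eigenfunction G \<tau> y" for k y
  proof -
    from that obtain c where c: "\<And>v. v \<in> carrier G \<Longrightarrow> \<tau> (v \<oplus> y) = c * \<tau> v"
      unfolding translation_eigenfunction_def by blast
    \<comment> \<open>Translations by x and y commute, so every component inherits the eigenvalue c
      of \<tau> itself.\<close>
    have "\<tau> (v \<oplus> y \<oplus> [i] \<cdot> x) = c * \<tau> (v \<oplus> [i] \<cdot> x)" if "v \<in> carrier G" for v and i :: nat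
      using c[of "v \<oplus> [i] \<cdot> x"] that x y by (simp add: a_ac)
    then have "T k (v \<oplus> y) = c * T k v" if "v \<in> carrier G" for v
      using that unfolding T_def by (simp add: sum_distrib_left mult_ac)
    then show ?thesis
      unfolding translation_eigenfunction_def by blast
  qed
qed

text \<open>Evaluating the eigenvalue equation at 0 gives
  \<open>\<tau> x = c x * \<tau> \<zero>\<close>. Either \<tau> vanishes on the carrier, or
  \<tau>(0) can be cancelled, which makes c multiplicative and \<tau> a scalar multiple of a
  character.\<close>

lemma simultaneous_eigenfunction_in_character_span:
  assumes fin: "finite (carrier G)"
    and eig: "\<And>x. x \<in> carrier G \<Longrightarrow> translation_eigenfunction G \<tau> x"
  shows "\<tau> \<in> character_span G"
proof -
  obtain c where c: "\<And>x v. x \<in> carrier G \<Longrightarrow> v \<in> carrier G \<Longrightarrow> \<tau> (v \<oplus> x) = c x * \<tau> v"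
    using eig unfolding translation_eigenfunction_def by metis
  have \<tau>: "\<tau> x = c x * \<tau> \<zero>" if "x \<in> carrier G" for x
    using c[OF that zero_closed] that by simp
  show ?thesis
  proof (cases "\<tau> \<zero> = 0")
    case True
    have "\<tau> v = 0" if "v \<in> carrier G" for v
      using \<tau>[OF that] True by simp
    then have "\<forall>v\<in>carrier G. \<tau> v = (\<Sum>\<chi>\<in>linear_characters G. 0 * \<chi> v)"
      by simp
    then show ?thesis
      unfolding character_span_def by (intro CollectI exI[of _ "\<lambda>_. 0"])
  next
    case False
    define \<psi> where "\<psi> = restrict c (carrier G)"
    have mult: "c (x \<oplus> y) = c x * c y" if "x \<in> carrier G" "y \<in> carrier G" for x y
      using c[OF that(2,1)] \<tau>[of "x \<oplus> y"] \<tau>[of x] False that by simp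
    have one: "c \<zero> = 1"
      using \<tau>[OF zero_closed] False by simp
    have "c x \<noteq> 0" if "x \<in> carrier G" for x
      using mult[of x "\<ominus> x"] one that by (auto simp: r_neg)
    with mult have \<psi>: "\<psi> \<in> linear_characters G"
      by (auto simp: linear_characters_def hom_def complex_units_def \<psi>_def)
    have "(\<Sum>\<chi>\<in>linear_characters G. (if \<chi> = \<psi> then \<tau> \<zero> else 0) * \<chi> v) = \<tau> v"
      if "v \<in> carrier G" for v
    proof -
      have "(\<Sum>\<chi>\<in>linear_characters G. (if \<chi> = \<psi> then \<tau> \<zero> else 0) * \<chi> v) =
          (\<Sum>\<chi>\<in>linear_characters G. if \<chi> = \<psi> then \<tau> \<zero> * \<psi> v else 0)"
        by (intro sum.cong) auto
      also have "\<dots> = \<tau> \<zero> * \<psi> v"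
        using finite_linear_characters[OF fin] \<psi> by simp
      finally show ?thesis
        using \<tau>[OF that] that by (simp add: \<psi>_def)
    qed
    then show ?thesis
      unfolding character_span_def by (intro CollectI exI[of _ "\<lambda>\<chi>. if \<chi> = \<psi> then \<tau> \<zero> else 0"]) simp
  qed
qed

text \<open>The induction is on a set S of translations for which \<tau> may fail to be an
  eigenfunction. Splitting \<tau> along some x in S removes x from S and spoils none of the others.
  With S the whole carrier the eigenfunction hypothesis is vacuous.\<close>

lemma character_span_UNIV:
  assumes fin: "finite (carrier G)"
  shows "\<tau> \<in> character_span G"
proof -
  have "\<tau> \<in> character_span G"
    if "finite S" "S \<subseteq> carrier G" "\<And>x. x \<in> carrier G - S \<Longrightarrow> translation_eigenfunction G \<tau> x" for S \<tau>
    using that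
  proof (induction S arbitrary: \<tau> rule: finite_induct)
    case empty
    then show ?case
      by (intro simultaneous_eigenfunction_in_character_span[OF fin]) auto
  next
    case (insert x S)
    then have x: "x \<in> carrier G" by simp
    obtain T where T: "\<And>v. v \<in> carrier G \<Longrightarrow> \<tau> v = (\<Sum>k<card (carrier G). T k v)"
      "\<And>k. translation_eigenfunction G (T k) x"
      "\<And>k y. y \<in> carrier G \<Longrightarrow> translation_eigenfunction G \<tau> y \<Longrightarrow> translation_eigenfunction G (T k) y"
      by (rule eigenfunction_decomposition[OF fin x, of \<tau>]) blast
    have "T k \<in> character_span G" for k
    proof (rule insert.IH)
      show "S \<subseteq> carrier G" using insert.prems by simp
      show "translation_eigenfunction G (T k) y" if "y \<in> carrier G - S" for y
        using that T(2,3) insert.prems(2) by (cases "y = x") auto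
    qed
    then show ?case
      by (rule character_span_sum[OF _ T(1)])
  qed
  from this[OF fin] show ?thesis by simp
qed

lemma character_coordinates_expansion:
  assumes "finite (carrier G)" "\<tau> \<in> extensional (carrier G)"
  shows "\<tau> = (\<lambda>v\<in>carrier G. \<Sum>\<chi>\<in>linear_characters G. character_coordinates G \<tau> \<chi> * \<chi> v)"
  unfolding character_coordinates_def
proof (rule someI_ex[where P = "\<lambda>c. \<tau> = (\<lambda>v\<in>carrier G. \<Sum>\<chi>\<in>linear_characters G. c \<chi> * \<chi> v)"])
  obtain c where "\<forall>v\<in>carrier G. \<tau> v = (\<Sum>\<chi>\<in>linear_characters G. c \<chi> * \<chi> v)"
    using character_span_UNIV[OF assms(1), of \<tau>] unfolding character_span_def by blast
  then have "\<tau> = (\<lambda>v\<in>carrier G. \<Sum>\<chi>\<in>linear_characters G. c \<chi> * \<chi> v)"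
    by (intro extensionalityI[OF assms(2) restrict_extensional]) simp
  then show "\<exists>c. \<tau> = (\<lambda>v\<in>carrier G. \<Sum>\<chi>\<in>linear_characters G. c \<chi> * \<chi> v)"
    by (rule exI[of _ c])
qed

end

section \<open>Isomorphisms of right modules\<close>

lemma abelian_group_of_comm_group: "comm_group (add_monoid M) \<Longrightarrow> abelian_group M"
  by (intro abelian_group.intro abelian_monoid.intro abelian_group_axioms.intro)
    (simp_all add: comm_group.axioms)

lemma comm_group_cong:
  assumes "comm_group A"
    and "carrier B = carrier A" "mult B = mult A" "one B = one A"
  shows "comm_group B"
proof -
  interpret A: comm_group A by (rule assms)
  show ?thesis
    by (rule comm_groupI) (use assms(2-4) A.l_inv_ex in \<open>auto simp: A.m_ac\<close>)
qed

text \<open>The module axioms of N are transported along the bijection. Thus they need not be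
  checked on coset representatives of the tensor product, nor through the inverse map that defines
  the action on the group algebra of V.\<close>

lemma is_rmodule_isoI:
  assumes M: "right_module R M" and N: "comm_group (add_monoid N)"
    and iso: "\<phi> \<in> iso (add_monoid M) (add_monoid N)"
    and smult: "\<And>m r. \<lbrakk>m \<in> carrier M; r \<in> carrier R\<rbrakk> \<Longrightarrow> \<phi> (m \<triangleleft>\<^bsub>M\<^esub> r) = \<phi> m \<triangleleft>\<^bsub>N\<^esub> r"
  shows "is_rmodule_iso R M N"
proof -
  interpret M: right_module R M by (rule M)
  interpret N: abelian_group N by (rule abelian_group_of_comm_group[OF N])
  have surj: "\<exists>m\<in>carrier M. n = \<phi> m" if "n \<in> carrier N" for n
    using iso that by (auto simp: iso_def bij_betw_def)
  have closed: "\<phi> m \<in> carrier N" if "m \<in> carrier M" for m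
    using iso that by (auto simp: iso_def hom_def)
  have add: "\<phi> m \<oplus>\<^bsub>N\<^esub> \<phi> n = \<phi> (m \<oplus>\<^bsub>M\<^esub> n)" if "m \<in> carrier M" "n \<in> carrier M" for m n
    using iso that by (auto simp: iso_def hom_def)
  note image = closed add smult[symmetric] M.rsmult_closed
  have "right_module R N"
  proof
    fix n r assume "n \<in> carrier N" "r \<in> carrier R"
    then show "n \<triangleleft>\<^bsub>N\<^esub> r \<in> carrier N"
      by (auto dest!: surj simp: image)
  next
    fix m n r assume "m \<in> carrier N" "n \<in> carrier N" "r \<in> carrier R"
    then show "(m \<oplus>\<^bsub>N\<^esub> n) \<triangleleft>\<^bsub>N\<^esub> r = m \<triangleleft>\<^bsub>N\<^esub> r \<oplus>\<^bsub>N\<^esub> n \<triangleleft>\<^bsub>N\<^esub> r"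
      by (auto dest!: surj simp: image M.rsmult_l_distr)
  next
    fix n r s assume "n \<in> carrier N" "r \<in> carrier R" "s \<in> carrier R"
    then show "n \<triangleleft>\<^bsub>N\<^esub> (r \<oplus>\<^bsub>R\<^esub> s) = n \<triangleleft>\<^bsub>N\<^esub> r \<oplus>\<^bsub>N\<^esub> n \<triangleleft>\<^bsub>N\<^esub> s"
      "n \<triangleleft>\<^bsub>N\<^esub> (r \<otimes>\<^bsub>R\<^esub> s) = (n \<triangleleft>\<^bsub>N\<^esub> r) \<triangleleft>\<^bsub>N\<^esub> s"
      by (auto dest!: surj simp: image M.rsmult_r_distr M.rsmult_assoc)
  next
    fix n assume "n \<in> carrier N"
    then show "n \<triangleleft>\<^bsub>N\<^esub> \<one>\<^bsub>R\<^esub> = n"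
      by (auto dest!: surj simp: image M.rsmult_one)
  qed
  with M iso smult show ?thesis
    by (auto simp: is_rmodule_iso_def rmodule_iso_def)
qed

lemma is_rmodule_iso_sym:
  assumes "is_rmodule_iso R M N"
  shows "is_rmodule_iso R N M"
proof -
  interpret M: right_module R M using assms by (simp add: is_rmodule_iso_def)
  interpret N: right_module R N using assms by (simp add: is_rmodule_iso_def)
  obtain \<phi> where iso: "\<phi> \<in> iso (add_monoid M) (add_monoid N)"
    and smult: "\<And>m r. \<lbrakk>m \<in> carrier M; r \<in> carrier R\<rbrakk> \<Longrightarrow> \<phi> (m \<triangleleft>\<^bsub>M\<^esub> r) = \<phi> m \<triangleleft>\<^bsub>N\<^esub> r"
    using assms by (auto simp: is_rmodule_iso_def rmodule_iso_def)
  have inj: "inj_on \<phi> (carrier M)" and img: "\<phi> ` carrier M = carrier N"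
    using iso by (auto simp: iso_def bij_betw_def)
  let ?\<psi> = "inv_into (carrier M) \<phi>"
  have \<psi>: "?\<psi> n \<in> carrier M" "\<phi> (?\<psi> n) = n" if "n \<in> carrier N" for n
    using that img by (auto simp: inv_into_into f_inv_into_f)
  have "?\<psi> (n \<triangleleft>\<^bsub>N\<^esub> r) = ?\<psi> n \<triangleleft>\<^bsub>M\<^esub> r" if "n \<in> carrier N" "r \<in> carrier R" for n r
    using that \<psi> smult by (intro inv_into_f_eq[OF inj]) (auto simp: M.rsmult_closed)
  moreover have "?\<psi> \<in> iso (add_monoid N) (add_monoid M)"
    using group.iso_set_sym[OF M.a_group iso] by simp
  ultimately show ?thesis
    using M.right_module_axioms N.right_module_axioms
    by (auto simp: is_rmodule_iso_def rmodule_iso_def)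
qed

section \<open>Group algebras\<close>

text \<open>The algebra element a is regarded as a finitely supported measure against which F is
  integrated. Its pairings determine a, so identities in the group algebra can be tested on all F;
  with F = 1 this is the augmentation.\<close>

definition pairing :: "('a \<Rightarrow>\<^sub>0 complex) \<Rightarrow> ('a \<Rightarrow> complex) \<Rightarrow> complex"
  where "pairing a F = (\<Sum>x\<in>Poly_Mapping.keys a. Poly_Mapping.lookup a x * F x)"

lemma pairing_superset:
  "finite S \<Longrightarrow> Poly_Mapping.keys a \<subseteq> S \<Longrightarrow> pairing a F = (\<Sum>x\<in>S. Poly_Mapping.lookup a x * F x)"
  unfolding pairing_def by (rule sum.mono_neutral_left) (auto simp: in_keys_iff)

lemma pairing_cong:
  "(\<And>x. x \<in> Poly_Mapping.keys a \<Longrightarrow> F x = F' x) \<Longrightarrow> pairing a F = pairing a F'"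
  unfolding pairing_def by (rule sum.cong) auto

lemma pairing_add: "pairing (a + b) F = pairing a F + pairing b F"
proof -
  let ?S = "Poly_Mapping.keys a \<union> Poly_Mapping.keys b"
  have "pairing (a + b) F = (\<Sum>x\<in>?S. Poly_Mapping.lookup (a + b) x * F x)"
    "pairing a F = (\<Sum>x\<in>?S. Poly_Mapping.lookup a x * F x)"
    "pairing b F = (\<Sum>x\<in>?S. Poly_Mapping.lookup b x * F x)"
    using Poly_Mapping.keys_add[of a b] by (intro pairing_superset; auto)+
  then show ?thesis
    by (simp add: lookup_add distrib_right sum.distrib)
qed

lemma pairing_zero [simp]: "pairing 0 F = 0"
  by (simp add: pairing_def)

lemma pairing_sum: "pairing (\<Sum>i\<in>I. a i) F = (\<Sum>i\<in>I. pairing (a i) F)"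
  by (induction I rule: infinite_finite_induct) (simp_all add: pairing_add)

lemma pairing_single [simp]: "pairing (Poly_Mapping.single x c) F = c * F x"
  by (cases "c = 0") (simp_all add: pairing_def)

lemma pairing_distrib: "pairing a (\<lambda>x. F x + F' x) = pairing a F + pairing a F'"
  by (simp add: pairing_def distrib_left sum.distrib)

lemma pairing_scale: "pairing a (\<lambda>x. c * F x) = c * pairing a F"
  by (simp add: pairing_def sum_distrib_left mult_ac)

lemma pairing_swap:
  "pairing a (\<lambda>x. pairing b (F x)) = pairing b (\<lambda>y. pairing a (\<lambda>x. F x y))"
  unfolding pairing_def sum_distrib_left
  by (subst sum.swap) (simp add: mult_ac)

lemma pairing_indicator: "pairing a (\<lambda>y. if y = x then 1 else 0) = Poly_Mapping.lookup a x"
proof -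
  have "pairing a (\<lambda>y. if y = x then 1 else 0) =
      (\<Sum>y\<in>Poly_Mapping.keys a. if y = x then Poly_Mapping.lookup a x else 0)"
    unfolding pairing_def by (intro sum.cong) auto
  then show ?thesis by (simp add: in_keys_iff)
qed

lemma pairing_eqI: "(\<And>F. pairing a F = pairing b F) \<Longrightarrow> a = b"
  by (metis pairing_indicator poly_mapping_eqI)

lemma group_algebra_simps [simp]:
  "a \<in> carrier (group_algebra G) \<longleftrightarrow> Poly_Mapping.keys a \<subseteq> carrier G"
  "a \<oplus>\<^bsub>group_algebra G\<^esub> b = a + b"
  "\<zero>\<^bsub>group_algebra G\<^esub> = 0"
  "\<one>\<^bsub>group_algebra G\<^esub> = Poly_Mapping.single \<one>\<^bsub>G\<^esub> 1"
  by (simp_all add: group_algebra_def)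

text \<open>Multiplication is convolution, so a product integrates as a double integral. Pairs (x,
  y) with the same product never have to be collected.\<close>

lemma pairing_mult:
  "pairing (a \<otimes>\<^bsub>group_algebra G\<^esub> b) F = pairing a (\<lambda>x. pairing b (\<lambda>y. F (x \<otimes>\<^bsub>G\<^esub> y)))"
  by (simp add: group_algebra_def pairing_sum)
    (simp add: pairing_def sum_distrib_left mult_ac)

lemma group_algebra_mult_single:
  "Poly_Mapping.single x c \<otimes>\<^bsub>group_algebra G\<^esub> Poly_Mapping.single y d =
    Poly_Mapping.single (x \<otimes>\<^bsub>G\<^esub> y) (c * d)"
  by (rule pairing_eqI) (simp add: pairing_mult)

lemma keys_sum_subset:
  "(\<And>i. i \<in> I \<Longrightarrow> Poly_Mapping.keys (a i) \<subseteq> S) \<Longrightarrow> Poly_Mapping.keys (\<Sum>i\<in>I. a i) \<subseteq> S"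
  using Poly_Mapping.keys_sum[of a I] by blast

lemma keys_add_subset:
  "Poly_Mapping.keys a \<subseteq> S \<Longrightarrow> Poly_Mapping.keys b \<subseteq> S \<Longrightarrow> Poly_Mapping.keys (a + b) \<subseteq> S"
  using Poly_Mapping.keys_add[of a b] by blast

lemma (in monoid) group_algebra_mult_closed:
  assumes "Poly_Mapping.keys a \<subseteq> carrier G" "Poly_Mapping.keys b \<subseteq> carrier G"
  shows "Poly_Mapping.keys (a \<otimes>\<^bsub>group_algebra G\<^esub> b) \<subseteq> carrier G"
  unfolding group_algebra_def
  by (simp, intro keys_sum_subset) (use assms in \<open>auto split: if_splits\<close>)

lemma abelian_group_group_algebra: "abelian_group (group_algebra G)"
  by (rule abelian_groupI)
    (auto simp: keys_add_subset add.assoc add.commute keys_minus intro!: bexI[of _ "- _"])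

lemma (in monoid) ring_group_algebra: "ring (group_algebra G)"
proof (rule ringI)
  show "abelian_group (group_algebra G)" by (rule abelian_group_group_algebra)
  have assoc: "pairing ((a \<otimes>\<^bsub>group_algebra G\<^esub> b) \<otimes>\<^bsub>group_algebra G\<^esub> c) F =
      pairing (a \<otimes>\<^bsub>group_algebra G\<^esub> (b \<otimes>\<^bsub>group_algebra G\<^esub> c)) F"
    if "Poly_Mapping.keys a \<subseteq> carrier G" "Poly_Mapping.keys b \<subseteq> carrier G"
      "Poly_Mapping.keys c \<subseteq> carrier G" for a b c F
    unfolding pairing_mult using that
    by (intro pairing_cong) (simp add: subset_iff m_assoc)
  show "monoid (group_algebra G)"
  proof (rule monoidI)
    fix a assume "a \<in> carrier (group_algebra G)"
    then have "Poly_Mapping.keys a \<subseteq> carrier G" by simp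
    then show "\<one>\<^bsub>group_algebra G\<^esub> \<otimes>\<^bsub>group_algebra G\<^esub> a = a"
      "a \<otimes>\<^bsub>group_algebra G\<^esub> \<one>\<^bsub>group_algebra G\<^esub> = a"
      by (auto intro!: pairing_eqI pairing_cong simp: pairing_mult subset_iff)
  qed (auto simp: group_algebra_mult_closed[THEN subsetD] intro!: pairing_eqI assoc)
qed (auto intro!: pairing_eqI simp: pairing_mult pairing_add pairing_distrib)

section \<open>The monomial module is a permutation module\<close>

lemma function_rmodule_comm_group:
  fixes G V act f
  defines "M \<equiv> function_rmodule G V act f"
  shows "comm_group (add_monoid M)"
proof -
  have "abelian_group M"
  proof (rule abelian_groupI)
    fix \<sigma> assume "\<sigma> \<in> carrier M"
    then show "\<exists>\<tau>\<in>carrier M. \<tau> \<oplus>\<^bsub>M\<^esub> \<sigma> = \<zero>\<^bsub>M\<^esub>"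
      by (intro bexI[of _ "\<lambda>v\<in>carrier V. - \<sigma> v"]) (auto simp: M_def function_rmodule_def)
  qed (auto simp: M_def function_rmodule_def PiE_iff add.assoc add.commute intro!: restrict_ext
      extensionalityI[where A = "carrier V"])
  then show ?thesis
    by (rule abelian_group.a_comm_group)
qed

locale finite_cocycle = right_action_by_automorphisms G V act
  for G :: "('g, 'k) monoid_scheme" (structure)
    and V :: "('v, 'l) ring_scheme" (structure)
    and act :: "'v \<Rightarrow> 'g \<Rightarrow> 'v" +
  fixes f :: "'g \<Rightarrow> 'v"
  assumes finite_G: "finite (carrier G)"
    and finite_V: "finite (carrier V)"
    and cocycle: "one_cocycle G V act f"
begin

abbreviation "M \<equiv> function_rmodule G V act f"

text \<open>The cocycle identity says precisely that \<open>v \<mapsto> vg + f(g)\<close> is a right action of \<open>G\<close> on the set \<open>V\<close>.\<close>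

definition affine :: "'v \<Rightarrow> 'g \<Rightarrow> 'v"
  where "affine v g = act v g \<oplus>\<^bsub>V\<^esub> f g"

lemma cocycle_closed [simp]: "g \<in> carrier G \<Longrightarrow> f g \<in> carrier V"
  using cocycle by (auto simp: one_cocycle_def)

lemma cocycle_mult:
  "x \<in> carrier G \<Longrightarrow> g \<in> carrier G \<Longrightarrow> f (x \<otimes> g) = act (f x) g \<oplus>\<^bsub>V\<^esub> f g"
  using cocycle by (auto simp: one_cocycle_def)

lemma act_closed [simp]: "v \<in> carrier V \<Longrightarrow> g \<in> carrier G \<Longrightarrow> act v g \<in> carrier V"
  using act_automorphism by (auto simp: iso_def hom_def)

lemma act_add:
  "v \<in> carrier V \<Longrightarrow> w \<in> carrier V \<Longrightarrow> g \<in> carrier G \<Longrightarrow>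
    act (v \<oplus>\<^bsub>V\<^esub> w) g = act v g \<oplus>\<^bsub>V\<^esub> act w g"
  using act_automorphism by (auto simp: iso_def hom_def)

lemma act_zero: "g \<in> carrier G \<Longrightarrow> act \<zero>\<^bsub>V\<^esub> g = \<zero>\<^bsub>V\<^esub>"
  using act_add[of "\<zero>\<^bsub>V\<^esub>" "\<zero>\<^bsub>V\<^esub>" g] by simp

lemma cocycle_one: "f \<one>\<^bsub>G\<^esub> = \<zero>\<^bsub>V\<^esub>"
  using cocycle_mult[OF G.one_closed G.one_closed] by (simp add: act_one)

lemma affine_closed [simp]: "v \<in> carrier V \<Longrightarrow> g \<in> carrier G \<Longrightarrow> affine v g \<in> carrier V"
  by (simp add: affine_def)

lemma affine_one: "v \<in> carrier V \<Longrightarrow> affine v \<one>\<^bsub>G\<^esub> = v"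
  by (simp add: affine_def act_one cocycle_one)

lemma affine_mult:
  "v \<in> carrier V \<Longrightarrow> x \<in> carrier G \<Longrightarrow> y \<in> carrier G \<Longrightarrow>
    affine v (x \<otimes> y) = affine (affine v x) y"
  by (simp add: affine_def act_mult act_add cocycle_mult V.a_assoc)

lemma affine_zero: "g \<in> carrier G \<Longrightarrow> affine \<zero>\<^bsub>V\<^esub> g = f g"
  by (simp add: affine_def act_zero)

lemma affine_inv_eq_iff:
  assumes "v \<in> carrier V" "w \<in> carrier V" "g \<in> carrier G"
  shows "affine v (inv g) = w \<longleftrightarrow> v = affine w g"
  using assms affine_mult[of v "inv g" g] affine_mult[of w g "inv g"] by (auto simp: affine_one)

lemma monomial_action_eq:
  assumes \<tau>: "\<tau> \<in> carrier V \<rightarrow>\<^sub>E UNIV" and g: "g \<in> carrier G"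
  shows "monomial_action G V act f \<tau> g = (\<lambda>v\<in>carrier V. \<tau> (affine v (inv g)))"
  unfolding monomial_action_def
proof (rule restrict_ext)
  fix v assume v: "v \<in> carrier V"
  have "\<chi> (f (inv g)) * translate G V act \<chi> g v = \<chi> (affine v (inv g))"
    if "\<chi> \<in> linear_characters V" for \<chi>
    using that v g by (simp add: translate_def affine_def V.linear_character_mult)
  then have "(\<Sum>\<chi>\<in>linear_characters V.
      character_coordinates V \<tau> \<chi> * (\<chi> (f (inv g)) * translate G V act \<chi> g v)) =
      (\<Sum>\<chi>\<in>linear_characters V. character_coordinates V \<tau> \<chi> * \<chi> (affine v (inv g)))"
    by simp
  \<comment> \<open>The moved point lies in the carrier, so the sum is the expansion of \<tau>
    evaluated there.\<close>
  also have "\<dots> = (\<lambda>v\<in>carrier V. \<Sum>\<chi>\<in>linear_characters V.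
      character_coordinates V \<tau> \<chi> * \<chi> v) (affine v (inv g))"
    using v g by simp
  also have "\<dots> = \<tau> (affine v (inv g))"
    using V.character_coordinates_expansion[OF finite_V, of \<tau>] \<tau> by (simp add: PiE_iff)
  finally show "(\<Sum>\<chi>\<in>linear_characters V.
      character_coordinates V \<tau> \<chi> * (\<chi> (f (inv g)) * translate G V act \<chi> g v)) =
      \<tau> (affine v (inv g))" .
qed

lemma function_rmodule_simps [simp]:
  "carrier M = carrier V \<rightarrow>\<^sub>E UNIV"
  "\<zero>\<^bsub>M\<^esub> = (\<lambda>v\<in>carrier V. 0)"
  "\<sigma> \<oplus>\<^bsub>M\<^esub> \<tau> = (\<lambda>v\<in>carrier V. \<sigma> v + \<tau> v)"
  by (simp_all add: function_rmodule_def)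

lemma function_rmodule_smult:
  assumes "\<tau> \<in> carrier V \<rightarrow>\<^sub>E UNIV" "Poly_Mapping.keys a \<subseteq> carrier G"
  shows "\<tau> \<triangleleft>\<^bsub>M\<^esub> a = (\<lambda>v\<in>carrier V. pairing a (\<lambda>g. \<tau> (affine v (inv g))))"
  unfolding function_rmodule_def pairing_def using assms
  by (auto intro!: restrict_ext sum.cong simp: monomial_action_eq subset_iff)

lemma right_module_function_rmodule: "right_module (group_algebra G) M"
proof (intro right_module.intro right_module_axioms.intro)
  show "ring (group_algebra G)"
    by (rule G.ring_group_algebra)
  show "abelian_group M"
    by (rule abelian_group_of_comm_group[OF function_rmodule_comm_group])
next
  fix \<tau> a assume "\<tau> \<in> carrier M" "a \<in> carrier (group_algebra G)"
  then show "\<tau> \<triangleleft>\<^bsub>M\<^esub> a \<in> carrier M"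
    by (simp add: function_rmodule_smult)
next
  fix \<sigma> \<tau> a assume "\<sigma> \<in> carrier M" "\<tau> \<in> carrier M" "a \<in> carrier (group_algebra G)"
  then show "(\<sigma> \<oplus>\<^bsub>M\<^esub> \<tau>) \<triangleleft>\<^bsub>M\<^esub> a = \<sigma> \<triangleleft>\<^bsub>M\<^esub> a \<oplus>\<^bsub>M\<^esub> \<tau> \<triangleleft>\<^bsub>M\<^esub> a"
    by (auto intro!: restrict_ext pairing_cong simp: function_rmodule_smult subset_iff
        simp flip: pairing_distrib)
next
  fix \<tau> a b assume "\<tau> \<in> carrier M" "a \<in> carrier (group_algebra G)" "b \<in> carrier (group_algebra G)"
  then show "\<tau> \<triangleleft>\<^bsub>M\<^esub> (a \<oplus>\<^bsub>group_algebra G\<^esub> b) = \<tau> \<triangleleft>\<^bsub>M\<^esub> a \<oplus>\<^bsub>M\<^esub> \<tau> \<triangleleft>\<^bsub>M\<^esub> b"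
    by (auto intro!: restrict_ext simp: function_rmodule_smult keys_add_subset pairing_add)
next
  fix \<tau> a b
  assume "\<tau> \<in> carrier M" and "a \<in> carrier (group_algebra G)" and "b \<in> carrier (group_algebra G)"
  then have \<tau>: "\<tau> \<in> carrier V \<rightarrow>\<^sub>E UNIV"
    and a: "Poly_Mapping.keys a \<subseteq> carrier G" and b: "Poly_Mapping.keys b \<subseteq> carrier G"
    by simp_all
  \<comment> \<open>Inversion reverses the product xy, so v is moved by the inverse of y first.
    Acting by a and then by b therefore nests the two sums in the opposite order, and they have to
    be exchanged.\<close>
  have "pairing a (\<lambda>x. pairing b (\<lambda>y. \<tau> (affine v (inv (x \<otimes> y))))) =
      pairing b (\<lambda>y. pairing a (\<lambda>x. \<tau> (affine (affine v (inv y)) (inv x))))"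
    if "v \<in> carrier V" for v
    unfolding pairing_swap[of a b] using that a b
    by (intro pairing_cong) (auto simp: subset_iff G.inv_mult_group affine_mult)
  then show "\<tau> \<triangleleft>\<^bsub>M\<^esub> (a \<otimes>\<^bsub>group_algebra G\<^esub> b) = (\<tau> \<triangleleft>\<^bsub>M\<^esub> a) \<triangleleft>\<^bsub>M\<^esub> b"
    using \<tau> a b function_rmodule_smult[OF \<tau> G.group_algebra_mult_closed[OF a b]]
    by (auto intro!: restrict_ext pairing_cong simp: function_rmodule_smult pairing_mult subset_iff)
next
  fix \<tau> assume "\<tau> \<in> carrier M"
  then show "\<tau> \<triangleleft>\<^bsub>M\<^esub> \<one>\<^bsub>group_algebra G\<^esub> = \<tau>"
    by (auto simp: function_rmodule_smult affine_one PiE_iff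
        intro: extensionalityI[where A = "carrier V"])
qed

lemma lookup_function_to_algebra:
  "Poly_Mapping.lookup (function_to_algebra V \<tau>) v = (if v \<in> carrier V then \<tau> v else 0)"
  by (simp add: function_to_algebra_def lookup_sum lookup_single when_def finite_V)

lemma function_to_algebra_iso:
  "function_to_algebra V \<in> iso (add_monoid M) (add_monoid (algebra_rmodule G V act f))"
proof -
  have keys: "Poly_Mapping.keys (function_to_algebra V \<tau>) \<subseteq> carrier V" for \<tau>
    by (auto simp: in_keys_iff lookup_function_to_algebra split: if_splits)
  have inj: "inj_on (function_to_algebra V) (carrier V \<rightarrow>\<^sub>E UNIV)"
  proof (rule inj_onI)
    fix \<sigma> \<tau> :: "'v \<Rightarrow> complex"
    assume "\<sigma> \<in> carrier V \<rightarrow>\<^sub>E UNIV" "\<tau> \<in> carrier V \<rightarrow>\<^sub>E UNIV"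
      and "function_to_algebra V \<sigma> = function_to_algebra V \<tau>"
    then show "\<sigma> = \<tau>"
      by (intro extensionalityI[of _ "carrier V"])
        (auto simp: PiE_iff lookup_function_to_algebra dest!: arg_cong[where f = Poly_Mapping.lookup]
          fun_cong split: if_splits)
  qed
  have "a \<in> function_to_algebra V ` (carrier V \<rightarrow>\<^sub>E UNIV)" if "Poly_Mapping.keys a \<subseteq> carrier V" for a
  proof (rule image_eqI)
    show "a = function_to_algebra V (\<lambda>v\<in>carrier V. Poly_Mapping.lookup a v)"
      using that by (auto intro!: poly_mapping_eqI simp: lookup_function_to_algebra in_keys_iff)
  qed auto
  with keys inj show ?thesis
    by (auto simp: iso_def bij_betw_def hom_def algebra_rmodule_def Let_def
        intro!: poly_mapping_eqI simp: lookup_function_to_algebra lookup_add)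
qed

text \<open>The action on the target is defined by pulling back along
  \<open>function_to_algebra\<close>; compatibility is just the cancellation of
  \<open>inv_into\<close> by injectivity.\<close>

lemma function_algebra_rmodule_iso:
  "is_rmodule_iso (group_algebra G) M (algebra_rmodule G V act f)"
proof (rule is_rmodule_isoI[OF right_module_function_rmodule _ function_to_algebra_iso])
  show "comm_group (add_monoid (algebra_rmodule G V act f))"
    by (rule comm_group_cong[OF abelian_group.a_comm_group[OF abelian_group_group_algebra[of "add_monoid V"]]])
      (simp_all add: algebra_rmodule_def Let_def)
  have "inj_on (function_to_algebra V) (carrier V \<rightarrow>\<^sub>E UNIV)"
    using function_to_algebra_iso by (simp add: iso_def bij_betw_def)
  then show "function_to_algebra V (\<tau> \<triangleleft>\<^bsub>M\<^esub> a) =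
      function_to_algebra V \<tau> \<triangleleft>\<^bsub>algebra_rmodule G V act f\<^esub> a" if "\<tau> \<in> carrier M" for \<tau> a
    using that by (simp add: algebra_rmodule_def Let_def inv_into_f_f)
qed

end

section \<open>Extension of scalars\<close>

text \<open>Cosets of the kernel are fibres of h, so membership in a coset becomes an equation
  between values of h.\<close>

lemma (in group_hom) r_coset_kernel:
  assumes y: "y \<in> carrier G"
  shows "kernel G H h #> y = {z \<in> carrier G. h z = h y}"
proof (intro equalityI subsetI)
  fix z assume "z \<in> kernel G H h #> y"
  then show "z \<in> {z \<in> carrier G. h z = h y}"
    using y by (auto simp: r_coset_def kernel_def)
next
  fix z assume z: "z \<in> {z \<in> carrier G. h z = h y}"
  then have "z \<otimes> inv y \<in> kernel G H h" "z = (z \<otimes> inv y) \<otimes> y"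
    using y by (auto simp: kernel_def G.m_assoc)
  then show "z \<in> kernel G H h #> y"
    unfolding r_coset_def by blast
qed

lemma (in abelian_group) add_minus_minus:
  assumes "x \<in> carrier G" "y \<in> carrier G"
  shows "(x \<oplus> y) \<ominus> x \<ominus> y = \<zero>"
proof -
  have "(x \<oplus> y) \<ominus> x = y"
    using assms by (simp add: minus_eq a_comm[of x y] a_assoc r_neg)
  then show ?thesis
    using assms by (simp add: minus_eq r_neg)
qed

context right_module
begin

lemma rsmult_zero:
  assumes "r \<in> carrier R"
  shows "\<zero>\<^bsub>M\<^esub> \<triangleleft>\<^bsub>M\<^esub> r = \<zero>\<^bsub>M\<^esub>"
  using rsmult_l_distr[OF M.zero_closed M.zero_closed assms] rsmult_closed[OF M.zero_closed assms]
  by simp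

lemma rsmult_minus:
  assumes "m \<in> carrier M" "n \<in> carrier M" "r \<in> carrier R"
  shows "(m \<ominus>\<^bsub>M\<^esub> n) \<triangleleft>\<^bsub>M\<^esub> r = m \<triangleleft>\<^bsub>M\<^esub> r \<ominus>\<^bsub>M\<^esub> n \<triangleleft>\<^bsub>M\<^esub> r"
proof -
  have "m \<triangleleft>\<^bsub>M\<^esub> r = ((m \<ominus>\<^bsub>M\<^esub> n) \<oplus>\<^bsub>M\<^esub> n) \<triangleleft>\<^bsub>M\<^esub> r"
    using assms by (simp add: M.minus_eq M.a_assoc M.l_neg)
  also have "\<dots> = (m \<ominus>\<^bsub>M\<^esub> n) \<triangleleft>\<^bsub>M\<^esub> r \<oplus>\<^bsub>M\<^esub> n \<triangleleft>\<^bsub>M\<^esub> r"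
    using assms by (simp add: rsmult_l_distr)
  finally show ?thesis
    using assms by (simp add: rsmult_closed M.minus_eq M.a_assoc M.r_neg)
qed

end

text \<open>Induction over a free abelian group builds elements by differences, hence the
  subtractive form here and in the neighbouring lemmas.\<close>

lemma hom_free_Abelian_group_diff:
  assumes M: "abelian_group M" and \<Psi>: "\<Psi> \<in> hom (free_Abelian_group S) (add_monoid M)"
    and "Poly_Mapping.keys x \<subseteq> S" "Poly_Mapping.keys y \<subseteq> S"
  shows "\<Psi> (x - y) = \<Psi> x \<ominus>\<^bsub>M\<^esub> \<Psi> y"
proof -
  interpret M: abelian_group M by (rule M)
  have xy: "Poly_Mapping.keys (x - y) \<subseteq> S"
    using assms(3,4) Poly_Mapping.keys_diff[of x y] by blast
  have closed: "\<Psi> z \<in> carrier M" if "Poly_Mapping.keys z \<subseteq> S" for z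
    using \<Psi> that by (auto simp: hom_def)
  have "\<Psi> ((x - y) + y) = \<Psi> (x - y) \<oplus>\<^bsub>M\<^esub> \<Psi> y"
    using hom_mult[OF \<Psi>, of "x - y" y] xy assms(4) by simp
  then show ?thesis
    using closed xy assms(3,4) by (simp add: M.minus_eq M.a_assoc M.r_neg)
qed

text \<open>This is the first isomorphism theorem for F modulo the relations, enriched by the action
  of A: compatibility with that action on generators is enough, since both sides are
  additive.\<close>

lemma extension_of_scalars_iso:
  fixes A :: "('a, 'l) ring_scheme" and R :: "('a, 'k) ring_scheme"
    and W :: "('a, 'w, 'x) rmodule_scheme" and M :: "('a, 'm, 'y) rmodule_scheme"
  defines "F \<equiv> free_Abelian_group (carrier W \<times> carrier A)"
  assumes M: "right_module A M"
    and \<Psi>: "\<Psi> \<in> hom F (add_monoid M)" and surj: "\<Psi> ` carrier F = carrier M"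
    and ker: "kernel F (add_monoid M) \<Psi> = generate F (tensor_relations R A W)"
    and smult: "\<And>w a b. \<lbrakk>w \<in> carrier W; a \<in> carrier A; b \<in> carrier A\<rbrakk> \<Longrightarrow>
      \<Psi> (frag_of (w, a \<otimes>\<^bsub>A\<^esub> b)) = \<Psi> (frag_of (w, a)) \<triangleleft>\<^bsub>M\<^esub> b"
  shows "is_rmodule_iso A M (extension_of_scalars R A W)"
proof -
  interpret M: right_module A M by (rule M)
  interpret h: group_hom F "add_monoid M" \<Psi>
    using \<Psi> M.a_group by (simp add: F_def group_hom_def group_hom_axioms_def)
  define K where "K = generate F (tensor_relations R A W)"
  define E where "E = extension_of_scalars R A W"
  define ext where "ext b = frag_extend (\<lambda>(w, a). frag_of (w :: 'w, a \<otimes>\<^bsub>A\<^esub> b))" for b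
  have E: "carrier E = carrier (F Mod K)" "\<zero>\<^bsub>E\<^esub> = \<one>\<^bsub>F Mod K\<^esub>" "add E = mult (F Mod K)"
    and E_smult: "X \<triangleleft>\<^bsub>E\<^esub> b = K <#>\<^bsub>F\<^esub> (ext b ` X)" for X b
    by (simp_all add: E_def extension_of_scalars_def Let_def F_def K_def ext_def)
  have K: "kernel F (add_monoid M) \<Psi> = K"
    using ker by (simp add: K_def)
  have coset: "K #>\<^bsub>F\<^esub> y = {z \<in> carrier F. \<Psi> z = \<Psi> y}" if "y \<in> carrier F" for y
    using h.r_coset_kernel[OF that] K by simp
  define \<theta> where "\<theta> X = the_elem (\<Psi> ` X)" for X
  have \<theta>_iso: "\<theta> \<in> iso (F Mod K) (add_monoid M)"
    using h.FactGroup_iso_set surj K by (simp add: \<theta>_def[abs_def])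
  have \<theta>_coset: "\<theta> (K #>\<^bsub>F\<^esub> y) = \<Psi> y" if "y \<in> carrier F" for y
  proof -
    have "\<Psi> ` (K #>\<^bsub>F\<^esub> y) = {\<Psi> y}"
      using that by (auto simp: coset)
    then show ?thesis by (simp add: \<theta>_def)
  qed
  have coset_in: "K #>\<^bsub>F\<^esub> y \<in> carrier (F Mod K)" if "y \<in> carrier F" for y
    using that by (auto simp: FactGroup_def RCOSETS_def)
  \<comment> \<open>Right multiplication by b on the second factor, extended to F, corresponds under
    \<Psi> to the action of b on M.\<close>
  have ext: "ext b x \<in> carrier F \<and> \<Psi> (ext b x) = \<Psi> x \<triangleleft>\<^bsub>M\<^esub> b"
    if b: "b \<in> carrier A" and x: "x \<in> carrier F" for b x
  proof -
    have "Poly_Mapping.keys x \<subseteq> carrier W \<times> carrier A"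
      using x by (simp add: F_def)
    then show ?thesis
    proof (induction x rule: free_Abelian_group_induct[consumes 1, case_names zero diff one])
      case zero
      then show ?case
        using b h.hom_one by (simp add: ext_def F_def M.rsmult_zero)
    next
      case (diff x y)
      have *: "Poly_Mapping.keys (ext b x - ext b y) \<subseteq> carrier W \<times> carrier A"
        using diff Poly_Mapping.keys_diff[of "ext b x" "ext b y"] by (auto simp: F_def)
      have "ext b (x - y) = ext b x - ext b y"
        by (simp add: ext_def frag_extend_diff)
      moreover have "\<Psi> x \<in> carrier M" "\<Psi> y \<in> carrier M"
        using diff h.hom_closed by (simp_all add: F_def)
      ultimately show ?case
        using diff b * hom_free_Abelian_group_diff[OF M.abelian_group_axioms \<Psi>[unfolded F_def]]
        by (simp add: F_def M.rsmult_minus)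
    next
      case (one p)
      then show ?case
        using b smult by (auto simp: ext_def F_def)
    qed
  qed
  \<comment> \<open>The action maps a coset elementwise and then adds K. All images have the same
    \<Psi>-value, so the result stays in one coset; x itself lies in its coset, so that coset is
    filled.\<close>
  have \<theta>_smult: "(K #>\<^bsub>F\<^esub> x) \<triangleleft>\<^bsub>E\<^esub> b = K #>\<^bsub>F\<^esub> ext b x"
    if b: "b \<in> carrier A" and x: "x \<in> carrier F" for b x
  proof (intro equalityI subsetI)
    fix z assume "z \<in> (K #>\<^bsub>F\<^esub> x) \<triangleleft>\<^bsub>E\<^esub> b"
    then obtain k y where k: "k \<in> K" and y: "y \<in> carrier F" "\<Psi> y = \<Psi> x" and z: "z = k \<otimes>\<^bsub>F\<^esub> ext b y"
      using x by (auto simp: E_smult set_mult_def coset)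
    have "k \<in> carrier F" "\<Psi> k = \<zero>\<^bsub>M\<^esub>"
      using k by (auto simp: K[symmetric] kernel_def)
    moreover have "\<Psi> y \<triangleleft>\<^bsub>M\<^esub> b \<in> carrier M"
      using h.hom_closed[OF y(1)] b by (simp add: M.rsmult_closed)
    ultimately have "z \<in> carrier F" "\<Psi> z = \<Psi> x \<triangleleft>\<^bsub>M\<^esub> b"
      using ext[OF b y(1)] y(2) z by (simp_all add: h.hom_mult)
    then show "z \<in> K #>\<^bsub>F\<^esub> ext b x"
      using ext[OF b x] by (simp add: coset)
  next
    fix z assume "z \<in> K #>\<^bsub>F\<^esub> ext b x"
    moreover have "x \<in> K #>\<^bsub>F\<^esub> x"
      using x by (simp add: coset)
    ultimately show "z \<in> (K #>\<^bsub>F\<^esub> x) \<triangleleft>\<^bsub>E\<^esub> b"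
      unfolding E_smult set_mult_def r_coset_def[of F K "ext b x"] by blast
  qed
  \<comment> \<open>The axioms are transported from M, which is known to be a module, so the map has
    to start at M: the inverse of \<theta>.\<close>
  let ?\<Phi> = "inv_into (carrier (F Mod K)) \<theta>"
  have inj: "inj_on \<theta> (carrier (F Mod K))"
    using \<theta>_iso by (simp add: iso_def bij_betw_def)
  have \<Phi>: "?\<Phi> (\<Psi> x) = K #>\<^bsub>F\<^esub> x" if "x \<in> carrier F" for x
    using that by (intro inv_into_f_eq[OF inj]) (auto simp: coset_in \<theta>_coset)
  have subgroup: "subgroup K F"
    using h.subgroup_kernel K by simp
  then have comm: "comm_group (F Mod K)"
    by (simp add: F_def comm_group.abelian_FactGroup abelian_free_Abelian_group)
  have "is_rmodule_iso A M E"
  proof (rule is_rmodule_isoI[OF M])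
    show "comm_group (add_monoid E)"
      by (rule comm_group_cong[OF comm]) (simp_all add: E)
    have "?\<Phi> \<in> iso (add_monoid M) (F Mod K)"
      using comm \<theta>_iso by (intro group.iso_set_sym) (auto simp: comm_group_def)
    then show "?\<Phi> \<in> iso (add_monoid M) (add_monoid E)"
      by (simp add: iso_def hom_def E)
    fix m b assume m: "m \<in> carrier M" and b: "b \<in> carrier A"
    obtain x where x: "x \<in> carrier F" "m = \<Psi> x"
      using m surj by blast
    show "?\<Phi> (m \<triangleleft>\<^bsub>M\<^esub> b) = ?\<Phi> m \<triangleleft>\<^bsub>E\<^esub> b"
      using x b ext[OF b x(1)] \<Phi>[of "ext b x"] by (simp add: \<Phi> \<theta>_smult)
  qed
  then show ?thesis by (simp add: E_def)
qed

section \<open>The induced module\<close>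

locale surjective_cocycle = finite_cocycle G V act f
  for G :: "('g, 'k) monoid_scheme" (structure)
    and V :: "('v, 'l) ring_scheme" (structure)
    and act :: "'v \<Rightarrow> 'g \<Rightarrow> 'v" and f :: "'g \<Rightarrow> 'v" +
  fixes H :: "'g set"
  assumes surjective: "f ` carrier G = carrier V"
    and H_def: "H = cocycle_kernel G V f"
begin

abbreviation "A \<equiv> group_algebra G"
abbreviation "B \<equiv> group_algebra (G\<lparr>carrier := H\<rparr>)"
abbreviation W :: "('g \<Rightarrow>\<^sub>0 complex, complex) rmodule"
  where "W \<equiv> trivial_rmodule"
abbreviation "F \<equiv> free_Abelian_group (carrier W \<times> carrier A)"
definition "K = generate F (tensor_relations B A W)"

definition point_mass :: "complex \<Rightarrow> 'v \<Rightarrow> complex"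
  where "point_mass c = (\<lambda>v\<in>carrier V. if v = \<zero>\<^bsub>V\<^esub> then c else 0)"

text \<open>The fibres of f are the right cosets of H, so this is a transversal of H in G indexed by
  V.\<close>

definition section_of :: "'v \<Rightarrow> 'g"
  where "section_of = inv_into (carrier G) f"

definition coset_basis :: "'v \<Rightarrow> 'g \<Rightarrow>\<^sub>0 complex"
  where "coset_basis v = Poly_Mapping.single (section_of v) 1"

text \<open>The normal form of a tensor with image \<tau>. Each coefficient sits inside a generator,
  so this map is additive only modulo \<open>K\<close>.\<close>

definition lift :: "('v \<Rightarrow> complex) \<Rightarrow> (complex \<times> ('g \<Rightarrow>\<^sub>0 complex)) \<Rightarrow>\<^sub>0 int"
  where "lift \<tau> = (\<Sum>v\<in>carrier V. frag_of (\<tau> v, coset_basis v))"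

lemma H_subset: "g \<in> H \<Longrightarrow> g \<in> carrier G" and H_zero: "g \<in> H \<Longrightarrow> f g = \<zero>\<^bsub>V\<^esub>"
  by (auto simp: H_def cocycle_kernel_def)

lemma section_of: "v \<in> carrier V \<Longrightarrow> section_of v \<in> carrier G" "v \<in> carrier V \<Longrightarrow> f (section_of v) = v"
  using surjective by (auto simp: section_of_def inv_into_into f_inv_into_f)

lemma trivial_rmodule_simps [simp]:
  "carrier W = UNIV"
  "c \<oplus>\<^bsub>W\<^esub> d = c + d"
  "c \<triangleleft>\<^bsub>W\<^esub> r = c * pairing r (\<lambda>_. 1)"
  by (simp_all add: trivial_rmodule_def pairing_def)

lemma point_mass_in [simp]: "point_mass c \<in> carrier V \<rightarrow>\<^sub>E UNIV"
  by (simp add: point_mass_def)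

text \<open>Moving v by the inverse of g hits 0 exactly when v = f(g). The value at v is therefore c
  times the total mass of a on the fibre of f over v.\<close>

lemma point_mass_smult:
  assumes "Poly_Mapping.keys a \<subseteq> carrier G"
  shows "point_mass c \<triangleleft>\<^bsub>M\<^esub> a = (\<lambda>v\<in>carrier V. c * pairing a (\<lambda>g. if f g = v then 1 else 0))"
proof -
  have "pairing a (\<lambda>g. point_mass c (affine v (inv g))) =
      pairing a (\<lambda>g. c * (if f g = v then 1 else 0))" if v: "v \<in> carrier V" for v
    using assms v affine_inv_eq_iff[of v "\<zero>\<^bsub>V\<^esub>"] affine_zero
    by (intro pairing_cong) (auto simp: point_mass_def subset_iff)
  then show ?thesis
    using assms by (auto intro!: restrict_ext simp: function_rmodule_smult pairing_scale)
qed

lemma keys_H_subset: "r \<in> carrier B \<Longrightarrow> Poly_Mapping.keys r \<subseteq> carrier G"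
  using H_subset by auto

text \<open>H fixes the point 0, so point masses at 0 form a copy of the trivial module. This is why
  the balancing relations hold in M.\<close>

lemma point_mass_smult_H:
  assumes r: "r \<in> carrier B"
  shows "point_mass c \<triangleleft>\<^bsub>M\<^esub> r = point_mass (c * pairing r (\<lambda>_. 1))"
proof -
  have "pairing r (\<lambda>g. if f g = v then 1 else 0) = (if v = \<zero>\<^bsub>V\<^esub> then pairing r (\<lambda>_. 1) else 0)" for v
  proof -
    have "pairing r (\<lambda>g. if f g = v then 1 else 0) = pairing r (\<lambda>_. if v = \<zero>\<^bsub>V\<^esub> then 1 else 0)"
      using r H_zero by (intro pairing_cong) auto
    also have "\<dots> = (if v = \<zero>\<^bsub>V\<^esub> then pairing r (\<lambda>_. 1) else 0)"
      by (auto simp: pairing_def)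
    finally show ?thesis .
  qed
  then show ?thesis
    unfolding point_mass_smult[OF keys_H_subset[OF r]] by (auto simp: point_mass_def)
qed

lemma tensor_relations_closed: "tensor_relations B A W \<subseteq> carrier F"
proof -
  have diff: "Poly_Mapping.keys (x - y) \<subseteq> S"
    if "Poly_Mapping.keys x \<subseteq> S" "Poly_Mapping.keys y \<subseteq> S"
    for x y :: "(complex \<times> ('g \<Rightarrow>\<^sub>0 complex)) \<Rightarrow>\<^sub>0 int" and S
    using that Poly_Mapping.keys_diff[of x y] by blast
  have mult: "Poly_Mapping.keys (r \<otimes>\<^bsub>A\<^esub> a) \<subseteq> carrier G"
    if "r \<in> carrier B" "Poly_Mapping.keys a \<subseteq> carrier G" for r a
    using that keys_H_subset G.group_algebra_mult_closed by simp
  show ?thesis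
    unfolding tensor_relations_def
    by (clarify, elim UnE CollectE exE conjE; hypsubst)
      (simp_all only: carrier_free_Abelian_group_iff,
       (intro diff; use mult in \<open>simp add: keys_add_subset\<close>)+)
qed

section \<open>Congruence modulo the tensor relations, written as
  \<open>x - y \<in> K\<close>\<close>

lemma K_subgroup: "subgroup K F"
  unfolding K_def
  using group.generate_is_subgroup[OF group_free_Abelian_group tensor_relations_closed] .

lemma K_zero: "0 \<in> K"
  using subgroup.one_closed[OF K_subgroup] by simp

lemma K_add: "x \<in> K \<Longrightarrow> y \<in> K \<Longrightarrow> x + y \<in> K"
  using subgroup.m_closed[OF K_subgroup] by simp

lemma K_minus: "x \<in> K \<Longrightarrow> - x \<in> K"
  using subgroup.m_inv_closed[OF K_subgroup, of x] subgroup.mem_carrier[OF K_subgroup, of x] by simp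

lemma K_diff: "x \<in> K \<Longrightarrow> y \<in> K \<Longrightarrow> x - y \<in> K"
  using K_add[of x "- y"] K_minus by simp

lemma K_sum: "(\<And>i. i \<in> I \<Longrightarrow> x i \<in> K) \<Longrightarrow> (\<Sum>i\<in>I. x i) \<in> K"
  by (induction I rule: infinite_finite_induct) (auto simp: K_zero K_add)

lemma K_trans: "x - y \<in> K \<Longrightarrow> y - z \<in> K \<Longrightarrow> x - z \<in> K"
  using K_add[of "x - y" "y - z"] by simp

lemma K_sum_diff:
  assumes "\<And>i. i \<in> I \<Longrightarrow> x i - y i \<in> K"
  shows "(\<Sum>i\<in>I. x i) - (\<Sum>i\<in>I. y i) \<in> K"
  using K_sum[of I "\<lambda>i. x i - y i"] assms by (simp add: sum_subtractf)

lemma tensor_add_left: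
  "a \<in> carrier A \<Longrightarrow> frag_of (c + d, a) - frag_of (c, a) - frag_of (d, a) \<in> K"
  unfolding K_def by (rule generate.incl) (fastforce simp: tensor_relations_def simp del: group_algebra_simps)

lemma tensor_add_right:
  "a \<in> carrier A \<Longrightarrow> b \<in> carrier A \<Longrightarrow> frag_of (c, a + b) - frag_of (c, a) - frag_of (c, b) \<in> K"
  unfolding K_def by (rule generate.incl) (fastforce simp: tensor_relations_def)

lemma tensor_balanced:
  "r \<in> carrier B \<Longrightarrow> a \<in> carrier A \<Longrightarrow>
    frag_of (c * pairing r (\<lambda>_. 1), a) - frag_of (c, r \<otimes>\<^bsub>A\<^esub> a) \<in> K"
  unfolding K_def by (rule generate.incl) (fastforce simp: tensor_relations_def)

text \<open>For c = d = 0 the additivity relation collapses to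
  \<open>- frag_of (0, a)\<close>.\<close>

lemma tensor_zero_left: "a \<in> carrier A \<Longrightarrow> frag_of (0, a) \<in> K"
  using K_minus[OF tensor_add_left[of a 0 0]] by simp

lemma tensor_zero_right: "frag_of (c, 0) \<in> K"
  using K_minus[OF tensor_add_right[of 0 0 c]] by simp

lemma tensor_sum_left:
  assumes "finite I" and a: "a \<in> carrier A"
  shows "frag_of (\<Sum>i\<in>I. c i, a) - (\<Sum>i\<in>I. frag_of (c i, a)) \<in> K"
  using assms(1)
proof (induction I rule: finite_induct)
  case empty
  then show ?case using tensor_zero_left[OF a] by simp
next
  case (insert i I)
  then show ?case
    using K_add[OF tensor_add_left[OF a, of "c i" "\<Sum>i\<in>I. c i"] insert.IH] by (simp add: algebra_simps)
qed

lemma tensor_sum_right: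
  assumes "finite I" and "\<And>i. i \<in> I \<Longrightarrow> a i \<in> carrier A"
  shows "frag_of (c, \<Sum>i\<in>I. a i) - (\<Sum>i\<in>I. frag_of (c, a i)) \<in> K"
  using assms
proof (induction I rule: finite_induct)
  case empty
  then show ?case using tensor_zero_right by simp
next
  case (insert i I)
  then have "(\<Sum>i\<in>I. a i) \<in> carrier A"
    by (simp add: keys_sum_subset)
  then show ?case
    using insert K_add[OF tensor_add_right[of "a i" "\<Sum>i\<in>I. a i" c] insert.IH]
    by (simp add: algebra_simps)
qed

lemma coset_basis_in: "v \<in> carrier V \<Longrightarrow> coset_basis v \<in> carrier A"
  by (simp add: coset_basis_def section_of)

text \<open>Let s be the representative of f(g). Then g s^-1 fixes 0, because f(s) = f(g), so it
  lies in H. Balancing with k times g s^-1, whose augmentation is k, replaces g by s and moves the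
  scalar to the left.\<close>

lemma tensor_single:
  assumes g: "g \<in> carrier G"
  shows "frag_of (c, Poly_Mapping.single g k) - frag_of (c * k, coset_basis (f g)) \<in> K"
proof -
  let ?s = "section_of (f g)"
  have s: "?s \<in> carrier G" "f ?s = f g"
    using g section_of by simp_all
  have "affine \<zero>\<^bsub>V\<^esub> (g \<otimes> inv ?s) = \<zero>\<^bsub>V\<^esub>"
    using g s affine_inv_eq_iff[of "f g" "\<zero>\<^bsub>V\<^esub>" ?s] by (simp add: affine_mult affine_zero)
  then have "g \<otimes> inv ?s \<in> H"
    using g s by (simp add: affine_zero H_def cocycle_kernel_def)
  then have "frag_of (c * k, coset_basis (f g)) -
      frag_of (c, Poly_Mapping.single (g \<otimes> inv ?s) k \<otimes>\<^bsub>A\<^esub> coset_basis (f g)) \<in> K"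
    using tensor_balanced[of "Poly_Mapping.single (g \<otimes> inv ?s) k" "coset_basis (f g)" c]
      coset_basis_in[of "f g"] g by simp
  moreover have "Poly_Mapping.single (g \<otimes> inv ?s) k \<otimes>\<^bsub>A\<^esub> coset_basis (f g) = Poly_Mapping.single g k"
    using g s by (simp add: coset_basis_def group_algebra_mult_single G.m_assoc)
  ultimately show ?thesis
    using K_minus by fastforce
qed

text \<open>The reduction to normal form for one generator: split a into single terms, replace each
  group element by its representative, and merge the coefficients over each fibre of f.\<close>

lemma lift_point_mass_smult:
  assumes a: "a \<in> carrier A"
  shows "frag_of (c, a) - lift (point_mass c \<triangleleft>\<^bsub>M\<^esub> a) \<in> K"
proof -
  let ?t = "\<lambda>g. c * Poly_Mapping.lookup a g"
  let ?S = "\<lambda>v. {g \<in> carrier G. f g = v}"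
  have keys: "Poly_Mapping.keys a \<subseteq> carrier G"
    using a by simp
  have a_sum: "a = (\<Sum>g\<in>carrier G. Poly_Mapping.single g (Poly_Mapping.lookup a g))"
    using keys finite_G
    by (intro poly_mapping_eqI) (auto simp: lookup_sum lookup_single when_def in_keys_iff)
  have "frag_of (c, a) - (\<Sum>g\<in>carrier G. frag_of (c, Poly_Mapping.single g (Poly_Mapping.lookup a g))) \<in> K"
    using tensor_sum_right[OF finite_G, of "\<lambda>g. Poly_Mapping.single g (Poly_Mapping.lookup a g)" c]
    by (simp flip: a_sum)
  moreover have "(\<Sum>g\<in>carrier G. frag_of (c, Poly_Mapping.single g (Poly_Mapping.lookup a g))) -
      (\<Sum>g\<in>carrier G. frag_of (?t g, coset_basis (f g))) \<in> K"
    by (intro K_sum_diff tensor_single)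
  ultimately have "frag_of (c, a) - (\<Sum>g\<in>carrier G. frag_of (?t g, coset_basis (f g))) \<in> K"
    by (rule K_trans)
  also have "(\<Sum>g\<in>carrier G. frag_of (?t g, coset_basis (f g))) =
      (\<Sum>v\<in>carrier V. \<Sum>g\<in>?S v. frag_of (?t g, coset_basis (f g)))"
    using sum.image_gen[OF finite_G, of "\<lambda>g. frag_of (?t g, coset_basis (f g))" f]
    by (simp only: surjective)
  also have "\<dots> = (\<Sum>v\<in>carrier V. \<Sum>g\<in>?S v. frag_of (?t g, coset_basis v))"
    by (intro sum.cong) auto
  finally have "frag_of (c, a) - (\<Sum>v\<in>carrier V. \<Sum>g\<in>?S v. frag_of (?t g, coset_basis v)) \<in> K" .
  moreover have "(\<Sum>v\<in>carrier V. frag_of (\<Sum>g\<in>?S v. ?t g, coset_basis v)) -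
      (\<Sum>v\<in>carrier V. \<Sum>g\<in>?S v. frag_of (?t g, coset_basis v)) \<in> K"
    using finite_G by (intro K_sum_diff tensor_sum_left coset_basis_in) auto
  ultimately have "frag_of (c, a) - (\<Sum>v\<in>carrier V. frag_of (\<Sum>g\<in>?S v. ?t g, coset_basis v)) \<in> K"
    using K_diff by fastforce
  moreover have "(\<Sum>g\<in>?S v. ?t g) = (point_mass c \<triangleleft>\<^bsub>M\<^esub> a) v" if "v \<in> carrier V" for v
  proof -
    have "(\<Sum>g\<in>?S v. ?t g) = (\<Sum>g\<in>carrier G. if f g = v then ?t g else 0)"
      using finite_G by (simp add: sum.inter_filter)
    also have "\<dots> = c * pairing a (\<lambda>g. if f g = v then 1 else 0)"
      by (auto simp: pairing_superset[OF finite_G keys] sum_distrib_left intro!: sum.cong)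
    finally show ?thesis
      using that keys by (simp add: point_mass_smult)
  qed
  ultimately show ?thesis
    by (simp add: lift_def)
qed

lemma function_rmodule_diff:
  assumes "\<sigma> \<in> carrier M" "\<tau> \<in> carrier M"
  shows "\<sigma> \<ominus>\<^bsub>M\<^esub> \<tau> = (\<lambda>v\<in>carrier V. \<sigma> v - \<tau> v)"
proof -
  interpret M: abelian_group M
    by (rule abelian_group_of_comm_group[OF function_rmodule_comm_group])
  let ?\<delta> = "\<lambda>v\<in>carrier V. \<sigma> v - \<tau> v"
  have \<delta>: "?\<delta> \<oplus>\<^bsub>M\<^esub> \<tau> = \<sigma>"
    using assms by (auto simp: PiE_iff intro: extensionalityI[where A = "carrier V"])
  have closed: "?\<delta> \<in> carrier M"
    by simp
  have "(?\<delta> \<oplus>\<^bsub>M\<^esub> \<tau>) \<ominus>\<^bsub>M\<^esub> \<tau> = ?\<delta> \<oplus>\<^bsub>M\<^esub> (\<tau> \<ominus>\<^bsub>M\<^esub> \<tau>)"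
    unfolding M.minus_eq using closed assms(2) by (intro M.a_assoc M.a_inv_closed)
  also have "\<dots> = ?\<delta>"
    unfolding M.minus_eq M.r_neg[OF assms(2)] using closed by (rule M.r_zero)
  finally show ?thesis
    unfolding \<delta> .
qed

lemma lift_diff:
  assumes "\<sigma> \<in> carrier M" "\<tau> \<in> carrier M"
  shows "(lift \<sigma> - lift \<tau>) - lift (\<sigma> \<ominus>\<^bsub>M\<^esub> \<tau>) \<in> K"
proof -
  have "(\<Sum>v\<in>carrier V. frag_of (\<sigma> v, coset_basis v) - frag_of (\<tau> v, coset_basis v)) -
      (\<Sum>v\<in>carrier V. frag_of (\<sigma> v - \<tau> v, coset_basis v)) \<in> K"
  proof (rule K_sum_diff)
    fix v assume "v \<in> carrier V"
    then show "frag_of (\<sigma> v, coset_basis v) - frag_of (\<tau> v, coset_basis v) -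
        frag_of (\<sigma> v - \<tau> v, coset_basis v) \<in> K"
      \<comment> \<open>The relation is taken for the decomposition of \<open>\<sigma> v\<close> as
        \<open>\<tau> v\<close> plus the difference.\<close>
      using tensor_add_left[OF coset_basis_in, of v "\<tau> v" "\<sigma> v - \<tau> v"] by simp
  qed
  then show ?thesis
    using assms by (simp add: lift_def function_rmodule_diff sum_subtractf cong: sum.cong)
qed

lemma lift_zero: "lift \<zero>\<^bsub>M\<^esub> \<in> K"
  unfolding lift_def by (intro K_sum) (simp add: tensor_zero_left coset_basis_in del: group_algebra_simps)

text \<open>The map \<open>c \<otimes> a \<mapsto> (c \<delta>\<^sub>0) a\<close> is injective because \<open>lift\<close> inverts it modulo \<open>K\<close>.\<close>

lemma function_rmodule_iso_induced:
  "is_rmodule_iso A M (induced_rmodule G H W)"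
  unfolding induced_rmodule_def
proof -
  interpret MM: right_module A M
    by (rule right_module_function_rmodule)
  let ?u = "\<lambda>(c, a). point_mass c \<triangleleft>\<^bsub>M\<^esub> a"
  have "?u ` (carrier W \<times> carrier A) \<subseteq> carrier (add_monoid M)"
  proof (intro image_subsetI)
    fix p assume "p \<in> carrier W \<times> carrier A"
    then show "?u p \<in> carrier (add_monoid M)"
      using MM.rsmult_closed[of "point_mass (fst p)" "snd p"] by (cases p) simp
  qed
  then obtain \<Psi> where \<Psi>: "\<Psi> \<in> hom F (add_monoid M)"
    and \<Psi>_gen: "\<And>p. p \<in> carrier W \<times> carrier A \<Longrightarrow> \<Psi> (frag_of p) = ?u p"
    using comm_group.free_Abelian_group_universal[OF MM.a_comm_group] by blast
  interpret h: group_hom F "add_monoid M" \<Psi>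
    using \<Psi> MM.a_group by (simp add: group_hom_def group_hom_axioms_def)
  have \<Psi>_frag: "\<Psi> (frag_of (c, a)) = point_mass c \<triangleleft>\<^bsub>M\<^esub> a" if "a \<in> carrier A" for c a
    using \<Psi>_gen[of "(c, a)"] that by simp
  have \<Psi>_diff: "\<Psi> (x - y) = \<Psi> x \<ominus>\<^bsub>M\<^esub> \<Psi> y" if "x \<in> carrier F" "y \<in> carrier F" for x y
    using hom_free_Abelian_group_diff[OF MM.abelian_group_axioms \<Psi>] that by simp
  have \<Psi>_closed: "\<Psi> x \<in> carrier M" if "x \<in> carrier F" for x
    using h.hom_closed[OF that] by simp
  have cancel: "\<Psi> (x - y - z) = \<zero>\<^bsub>M\<^esub>"
    if "x \<in> carrier F" "y \<in> carrier F" "z \<in> carrier F" "\<Psi> x = \<Psi> y \<oplus>\<^bsub>M\<^esub> \<Psi> z" for x y z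
  proof -
    have "x - y \<in> carrier F"
      using that Poly_Mapping.keys_diff[of x y] by (fastforce simp only: carrier_free_Abelian_group_iff)
    then have "\<Psi> (x - y - z) = \<Psi> x \<ominus>\<^bsub>M\<^esub> \<Psi> y \<ominus>\<^bsub>M\<^esub> \<Psi> z"
      using that by (simp only: \<Psi>_diff)
    also have "\<dots> = \<zero>\<^bsub>M\<^esub>"
      unfolding that(4) using that(2,3)[THEN \<Psi>_closed] by (rule MM.add_minus_minus)
    finally show ?thesis .
  qed
  have in_F: "frag_of (c, a) \<in> carrier F" if "a \<in> carrier A" for c a
    using that by simp
  have "kernel F (add_monoid M) \<Psi> = K"
  proof
    have "tensor_relations B A W \<subseteq> kernel F (add_monoid M) \<Psi>"
    proof
      fix x assume x: "x \<in> tensor_relations B A W"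
      then have "\<Psi> x = \<zero>\<^bsub>M\<^esub>"
        unfolding tensor_relations_def
      proof (elim UnE CollectE exE conjE)
        fix c d a assume x: "x = frag_of (c \<oplus>\<^bsub>W\<^esub> d, a) - frag_of (c, a) - frag_of (d, a)"
          and a: "a \<in> carrier A"
        have "point_mass (c + d) = point_mass c \<oplus>\<^bsub>M\<^esub> point_mass d"
          by (auto simp: point_mass_def)
        then have "\<Psi> (frag_of (c + d, a)) = \<Psi> (frag_of (c, a)) \<oplus>\<^bsub>M\<^esub> \<Psi> (frag_of (d, a))"
          using a MM.rsmult_l_distr[of "point_mass c" "point_mass d" a] by (simp add: \<Psi>_frag)
        then show "\<Psi> x = \<zero>\<^bsub>M\<^esub>"
          unfolding x trivial_rmodule_simps using a by (intro cancel in_F)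
      next
        fix c a b assume x: "x = frag_of (c, a \<oplus>\<^bsub>A\<^esub> b) - frag_of (c, a) - frag_of (c, b)"
          and ab: "a \<in> carrier A" "b \<in> carrier A"
        then have "\<Psi> (frag_of (c, a \<oplus>\<^bsub>A\<^esub> b)) = \<Psi> (frag_of (c, a)) \<oplus>\<^bsub>M\<^esub> \<Psi> (frag_of (c, b))"
          using MM.rsmult_r_distr[of "point_mass c" a b] by (simp add: \<Psi>_frag keys_add_subset)
        then show "\<Psi> x = \<zero>\<^bsub>M\<^esub>"
          unfolding x using ab by (intro cancel in_F MM.R.add.m_closed)
      next
        fix c r a assume x: "x = frag_of (c \<triangleleft>\<^bsub>W\<^esub> r, a) - frag_of (c, r \<otimes>\<^bsub>A\<^esub> a)"
          and r: "r \<in> carrier B" and a: "a \<in> carrier A"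
        have r': "r \<in> carrier A"
          using keys_H_subset[OF r] by simp
        then have "\<Psi> (frag_of (c, r \<otimes>\<^bsub>A\<^esub> a)) = (point_mass c \<triangleleft>\<^bsub>M\<^esub> r) \<triangleleft>\<^bsub>M\<^esub> a"
          using a MM.rsmult_assoc[of "point_mass c" r a] by (simp add: \<Psi>_frag G.group_algebra_mult_closed)
        then have eq: "\<Psi> (frag_of (c \<triangleleft>\<^bsub>W\<^esub> r, a)) = \<Psi> (frag_of (c, r \<otimes>\<^bsub>A\<^esub> a))"
          unfolding point_mass_smult_H[OF r] trivial_rmodule_simps \<Psi>_frag[OF a] by simp
        have "frag_of (c \<triangleleft>\<^bsub>W\<^esub> r, a) \<in> carrier F" "frag_of (c, r \<otimes>\<^bsub>A\<^esub> a) \<in> carrier F"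
          by (rule in_F[OF a], rule in_F[OF MM.R.m_closed[OF r' a]])
        then show "\<Psi> x = \<zero>\<^bsub>M\<^esub>"
          unfolding x using eq \<Psi>_closed by (simp only: \<Psi>_diff MM.M.minus_eq MM.M.r_neg)
      qed
      then show "x \<in> kernel F (add_monoid M) \<Psi>"
        using subsetD[OF tensor_relations_closed x] by (simp add: kernel_def)
    qed
    then show "K \<subseteq> kernel F (add_monoid M) \<Psi>"
      unfolding K_def by (intro group.generate_subgroup_incl[OF group_free_Abelian_group] h.subgroup_kernel)
  next
    have "x - lift (\<Psi> x) \<in> K" if "x \<in> carrier F" for x
    proof -
      have "Poly_Mapping.keys x \<subseteq> carrier W \<times> carrier A"
        using that by simp
      then show ?thesis
      proof (induction x rule: free_Abelian_group_induct[consumes 1, case_names zero diff one])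
        case zero
        then show ?case
          using K_minus[OF lift_zero] h.hom_one
          by (simp only: one_free_Abelian_group monoid.select_convs diff_0)
      next
        case (diff x y)
        then have xy: "x \<in> carrier F" "y \<in> carrier F" by simp_all
        have "(x - y) - (lift (\<Psi> x) - lift (\<Psi> y)) \<in> K"
          using K_diff[OF diff.IH] by (simp add: algebra_simps)
        then show ?case
          using K_trans lift_diff[OF \<Psi>_closed \<Psi>_closed] \<Psi>_diff xy by simp
      next
        case (one p)
        then show ?case
          using lift_point_mass_smult \<Psi>_frag by (cases p) (simp del: group_algebra_simps)
      qed
    qed
    \<comment> \<open>For x in the kernel the congruence leaves the lift of zero, which is not
      literally 0 but a sum of terms 0 \<otimes> s(v), and these lie in \<open>K\<close>.\<close>
    then have "x \<in> K" if "x \<in> carrier F" "\<Psi> x = \<zero>\<^bsub>M\<^esub>" for x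
      using K_add[OF _ lift_zero, of "x - lift \<zero>\<^bsub>M\<^esub>"] that
      by (metis diff_add_cancel)
    then show "kernel F (add_monoid M) \<Psi> \<subseteq> K"
      by (auto simp: kernel_def)
  qed
  moreover have "\<Psi> ` carrier F = carrier M"
  proof
    show "\<Psi> ` carrier F \<subseteq> carrier M"
      using \<Psi>_closed by blast
    show "carrier M \<subseteq> \<Psi> ` carrier F"
    proof
      fix \<tau> assume \<tau>: "\<tau> \<in> carrier M"
      \<comment> \<open>Placing mass \<tau>(w) on the representative of w gives each fibre the right
        total, so the single generator (1, a) already maps to \<tau>.\<close>
      define a where "a = (\<Sum>w\<in>carrier V. Poly_Mapping.single (section_of w) (\<tau> w))"
      have a: "a \<in> carrier A"
        unfolding a_def by (simp, intro keys_sum_subset) (auto simp: section_of split: if_splits)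
      have "pairing a (\<lambda>g. if f g = v then 1 else 0) = \<tau> v" if "v \<in> carrier V" for v
      proof -
        have "pairing a (\<lambda>g. if f g = v then 1 else 0) = (\<Sum>w\<in>carrier V. if w = v then \<tau> w else 0)"
          unfolding a_def pairing_sum by (intro sum.cong) (auto simp: section_of)
        then show ?thesis
          using that finite_V by simp
      qed
      then have "\<tau> = \<Psi> (frag_of (1, a))"
        using a \<tau> by (auto simp: \<Psi>_frag point_mass_smult PiE_iff
            intro: extensionalityI[where A = "carrier V"])
      then show "\<tau> \<in> \<Psi> ` carrier F"
        using a by (auto intro!: image_eqI)
    qed
  qed
  moreover have "\<Psi> (frag_of (c, a \<otimes>\<^bsub>A\<^esub> b)) = \<Psi> (frag_of (c, a)) \<triangleleft>\<^bsub>M\<^esub> b"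
    if "a \<in> carrier A" "b \<in> carrier A" for c a b
    using that MM.rsmult_assoc[of "point_mass c" a b] G.group_algebra_mult_closed[of a b]
    by (simp add: \<Psi>_frag)
  ultimately show "is_rmodule_iso A M (extension_of_scalars B A W)"
    unfolding K_def by (intro extension_of_scalars_iso[OF right_module_function_rmodule \<Psi>])
qed

end

theorem theorem2p8:
  fixes G :: "('g, 'k) monoid_scheme"
    and V :: "('v, 'l) ring_scheme"
    and act :: "'v \<Rightarrow> 'g \<Rightarrow> 'v"
    and f :: "'g \<Rightarrow> 'v"
    and H :: "'g set"
  assumes "right_action_by_automorphisms G V act"
    and "finite (carrier G)"
    and "finite (carrier V)"
    and "one_cocycle G V act f"
    and "f ` carrier G = carrier V"
    and "H = cocycle_kernel G V f"
  shows "is_rmodule_iso (group_algebra G) (algebra_rmodule G V act f) (function_rmodule G V act f)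
    \<and> is_rmodule_iso (group_algebra G) (function_rmodule G V act f)
         (induced_rmodule G H trivial_rmodule)"
proof -
  interpret surjective_cocycle G V act f H
    using assms by (simp add: surjective_cocycle_def finite_cocycle_def
        surjective_cocycle_axioms_def finite_cocycle_axioms_def)
  show ?thesis
    using is_rmodule_iso_sym[OF function_algebra_rmodule_iso] function_rmodule_iso_induced by blast
qed

end
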